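(* Let $-f<0$ be a fundamental discriminant and let $\chi=\chi_{-f}=\left(\frac{-f}{\cdot}\right)$ be the associated odd, primitive, quadratic Dirichlet character of conductor $f$. Put \[ \alpha_f := \prod_{0<u<\frac{f}{2}} \left|2\sin\left(\frac{\pi u}{f}\right)\right|^{-2\chi(u)u}, \] where the product runs over the integers $u$ with $0<u<f/2$. Then \[ \mathrm{m}\left(\alpha_f \prod_{0<u<\frac{f}{2}} \left(x+y+2\sin\frac{\pi u}{f}\right)^{\chi(u) f}\right) = 2\,L'(\chi_{-f},-1), \] where $\mathrm{m}$ denotes the logarithmic Mahler measure of a rational function in the two variables $x,y$.
   Context: For a nonzero rational function $P \in \mathbf{C}(x_1,\dots,x_n)^{\times}$, the (logarithmic) Mahler measure is the real number \[ \mathrm{m}(P) := \frac{1}{(2\pi \mathrm{i})^n}\int_{\mathbf{T}^n}\log|P(x_1,\dots,x_n)|\,\frac{\mathrm{d}x_1}{x_1}\cdots\frac{\mathrm{d}x_n}{x_n}, \] where $\mathbf{T}^n=\{(x_1,\dots,x_n)\in\mathbf{C}^n : |x_1|=\cdots=|x_n|=1\}$ is the complex unit torus (here $n=2$ with variables $x,y$). For a fundamental discriminant $-f<0$, $\chi_{-f}=\left(\frac{-f}{\cdot}\right)$ is the Kronecker symbol, viewed as a Dirichlet character of conductor $f$ (it is odd, primitive and quadratic). $L(\chi_{-f},s)$ is its Dirichlet $L$-function, analytically continued to $\mathbf{C}$, and $L'(\chi_{-f},-1)$ is the value of its derivative at $s=-1$. The exponents $\chi(u)f$ and $-2\chi(u)u$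 are integers that may be negative or zero, so the argument of $\mathrm{m}$ is a rational function in $x,y$ with real coefficients. *)

theory Defs
  imports
    "HOL-Complex_Analysis.Complex_Analysis"
    "HOL-Number_Theory.Number_Theory"
    "HOL-Computational_Algebra.Squarefree"
begin

(* Isabelle's mod and div on int round towards minus infinity, so the residue conditions
   below are meaningful for negative D. The trivial discriminant 1 is admitted here. *)
definition fundamental_discriminant :: "int \<Rightarrow> bool" where
  "fundamental_discriminant D \<longleftrightarrow>
     (D mod 4 = 1 \<and> squarefree D) \<or>
     (D mod 4 = 0 \<and> squarefree (D div 4) \<and> (D div 4) mod 4 \<in> {2, 3})"

definition kronecker_prime :: "int \<Rightarrow> nat \<Rightarrow> int" where
  "kronecker_prime a p =
     (if p = 2 then (if even a then 0 else if a mod 8 \<in> {1, 7} then 1 else -1)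
      else Legendre a (int p))"

(* The Kronecker symbol (a/n) for n >= 0, the only range a Dirichlet series needs. *)
definition kronecker :: "int \<Rightarrow> nat \<Rightarrow> int" where
  "kronecker a n =
     (if n = 0 then (if \<bar>a\<bar> = 1 then 1 else 0)
      else (\<Prod>p\<in>prime_factors n. kronecker_prime a p ^ multiplicity p n))"

(* The unique entire function extending the Dirichlet series. It exists for every
   non-principal Dirichlet character c; for other c the value may be unspecified. *)
definition dirichlet_L :: "(nat \<Rightarrow> complex) \<Rightarrow> complex \<Rightarrow> complex" where
  "dirichlet_L c =
     (THE L. L holomorphic_on UNIV \<and>
        (\<forall>s. Re s > 1 \<longrightarrow> (\<lambda>n. c (Suc n) / of_nat (Suc n) powr s) sums L s))"

(* Logarithmic Mahler measure in two variables. With x = exp(i s) and y = exp(i t) one has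
   dx/x = i ds and dy/y = i dt, which cancels the factor i^2 of (2 pi i)^2.
   A rational function is given by its values; where Isabelle's totalised inverse, powi or ln
   (1/0 = 0, ln 0 = 0) assigns an artificial value, i.e. on the zeros and poles of a nonzero
   rational function, the set concerned is a null set of the torus. *)
definition mahler_measure2 :: "(complex \<Rightarrow> complex \<Rightarrow> complex) \<Rightarrow> real" where
  "mahler_measure2 P =
     1 / (2 * pi)\<^sup>2 *
     (LINT z : {0..2 * pi} \<times> {0..2 * pi} | lborel. ln (cmod (P (cis (fst z)) (cis (snd z)))))"

definition chi_neg :: "nat \<Rightarrow> nat \<Rightarrow> int" where
  "chi_neg f n = kronecker (- int f) n"

definition alpha :: "nat \<Rightarrow> real" where
  "alpha f =
     (\<Prod>u | 0 < u \<and> real u < real f / 2.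
        \<bar>2 * sin (pi * real u / real f)\<bar> powi (- 2 * chi_neg f u * int u))"

end

theory Submission
  imports Defs "HOL-Real_Asymp.Real_Asymp"
begin

text \<open>
  Write \<open>\<Psi>(t)\<close> for the integral of \<open>ln (2 sin (\<pi> y))\<close> over \<open>[t, 1/2]\<close>. Both sides are expressed through
  the values \<open>\<Psi>(u/f)\<close>, so that neither Gauss sums nor the functional equation are needed.

  Mahler measure: after rotating \<open>y\<close> by \<open>x\<close>, Jensen's formula gives
  \<open>m(x + y + a) = E[ln max(|1 + v|, a)]\<close> for \<open>v\<close> uniform on the unit circle, and for \<open>a = 2 sin (\<pi> t)\<close> this is
  \<open>2 t ln a + 2 \<Psi>(t)\<close>. The factor \<open>alpha\<close> cancels the terms \<open>2 t ln a\<close>.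

  L-value: repeated summation by parts continues the Dirichlet series of a periodic mean-zero
  coefficient sequence to the whole plane, and expresses \<open>L'(-1)\<close> as the limit of \<open>-\<Sum> \<chi>(n) n ln n\<close>
  corrected by boundary terms. For odd \<open>\<chi>\<close> the terms \<open>u\<close> and \<open>f - u\<close> combine, and the sums
  converge, after a correction of the same shape, to \<open>\<Psi>(u/f)\<close>; since the total converges, the
  corrections must cancel, and \<open>L'(-1) = f \<Sum>\<^sub>u \<chi>(u) \<Psi>(u/f)\<close> with \<open>0 < u < f/2\<close>.

  That the Kronecker symbol is periodic and odd follows from quadratic reciprocity by factoring the
  discriminant into the prime discriminants \<open>-4\<close>, \<open>8\<close>, \<open>-8\<close> and \<open>\<plusminus>p \<equiv> 1 (mod 4)\<close>.
\<close>

subsection \<open>The Kronecker symbol of a fundamental discriminant\<close>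

lemma Legendre_cong:
  assumes "[a = b] (mod p)"
  shows "Legendre a p = Legendre b p"
proof -
  have "[a = 0] (mod p) \<longleftrightarrow> [b = 0] (mod p)"
    using assms cong_sym cong_trans by blast
  moreover have "QuadRes p a \<longleftrightarrow> QuadRes p b"
    unfolding QuadRes_def using assms cong_sym cong_trans by blast
  ultimately show ?thesis by (simp add: Legendre_def)
qed

text \<open>Euler's criterion determines the symbol modulo \<open>p\<close>, and two elements of
  {-1, 0, 1} that are congruent modulo \<open>p > 2\<close> are equal.\<close>

lemma Legendre_eqI:
  assumes "prime p" "2 < p" "c \<in> {-1, 0, 1}" "[a ^ ((p - 1) div 2) = c] (mod int p)"
  shows "Legendre a (int p) = c"
proof -
  have "[Legendre a (int p) = c] (mod int p)"
    using euler_criterion[OF assms(1,2)] assms(4) cong_trans by blast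
  then have "int p dvd Legendre a (int p) - c"
    by (simp add: cong_iff_dvd_diff)
  moreover have "\<bar>Legendre a (int p) - c\<bar> < int p"
    using assms(2,3) by (auto simp: Legendre_def)
  ultimately have "Legendre a (int p) - c = 0"
    using zdvd_not_zless[of "\<bar>Legendre a (int p) - c\<bar>" "int p"] by auto
  then show ?thesis by simp
qed

lemma Legendre_mult:
  assumes "prime p" "2 < p"
  shows "Legendre (a * b) (int p) = Legendre a (int p) * Legendre b (int p)"
proof (rule Legendre_eqI[OF assms])
  show "Legendre a (int p) * Legendre b (int p) \<in> {-1, 0, 1}"
    by (auto simp: Legendre_def)
  show "[(a * b) ^ ((p - 1) div 2) = Legendre a (int p) * Legendre b (int p)] (mod int p)"
    unfolding power_mult_distrib
    by (intro cong_mult cong_sym[OF euler_criterion[OF assms]])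
qed

lemma Legendre_minus_one:
  assumes "prime p" "2 < p"
  shows "Legendre (-1) (int p) = (-1) ^ ((p - 1) div 2)"
  by (rule Legendre_eqI[OF assms]) (auto simp: minus_one_power_iff)

lemma Legendre_one:
  assumes "prime p" "2 < p"
  shows "Legendre 1 (int p) = 1"
  by (rule Legendre_eqI[OF assms]) auto

text \<open>Gauss's lemma for the multiplier 2: with \<open>h = (p - 1) / 2\<close>, the sign counts
  the \<open>x \<le> h\<close> whose double exceeds \<open>h\<close>. There are
  \<open>h - h div 2\<close> of them, and the parity of this number depends on
  \<open>h mod 4\<close>, hence on \<open>p mod 8\<close>.\<close>

lemma Legendre_two:
  assumes "prime p" "2 < p"
  shows "Legendre 2 (int p) = (if p mod 8 \<in> {1, 7} then 1 else -1)"
proof -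
  have odd: "odd p" using assms prime_odd_nat by blast
  interpret GAUSS p 2
    by unfold_locales (use assms in \<open>auto simp: cong_def\<close>)
  define h where "h = (int p - 1) div 2"
  have p: "int p = 2 * h + 1" unfolding h_def using odd by presburger
  \<comment> \<open>Doubling a number up to \<open>h\<close> stays below \<open>p\<close>, so no
    reduction modulo \<open>p\<close> takes place.\<close>
  have C: "C = (\<lambda>x. 2 * x) ` {0<..h}"
    unfolding C_def B_def A_def h_def[symmetric] image_image
    by (intro image_cong refl) (use p in auto)
  have "E = (\<lambda>x. 2 * x) ` {h div 2<..h}"
    unfolding E_def C h_def[symmetric] using p assms(2) by (auto simp: image_iff)
  moreover have "inj_on (\<lambda>x::int. 2 * x) {h div 2<..h}" by (auto simp: inj_on_def)
  ultimately have "card E = nat (h - h div 2)" by (simp add: card_image)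
  then have L: "Legendre 2 (int p) = (-1) ^ nat (h - h div 2)"
    using gauss_lemma by simp
  have "h \<ge> 0" using p by presburger
  then have "even (nat (h - h div 2)) \<longleftrightarrow> even (h - h div 2)"
    by (subst even_nat_iff) (auto)
  also have "\<dots> \<longleftrightarrow> p mod 8 \<in> {1, 7}"
  proof -
    define j where "j = h div 4"
    have "h = 4 * j + h mod 4" by (simp add: j_def)
    moreover have "h mod 4 \<in> {0, 1, 2, 3}" by simp presburger
    ultimately consider "h = 4 * j" | "h = 4 * j + 1" | "h = 4 * j + 2" | "h = 4 * j + 3" by force
    moreover have "int (p mod 8) = (2 * h + 1) mod 8" by (simp add: zmod_int p)
    then have "p mod 8 \<in> {1, 7} \<longleftrightarrow> (2 * h + 1) mod 8 \<in> {1, 7}" by auto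
    ultimately show ?thesis
    proof cases
      case 1
      then have "h - h div 2 = 2 * j" "2 * h + 1 = 8 * j + 1" by presburger+
      then show ?thesis using \<open>p mod 8 \<in> _ \<longleftrightarrow> _\<close> by simp
    next
      case 2
      then have "h - h div 2 = 2 * j + 1" "2 * h + 1 = 8 * j + 3" by presburger+
      then show ?thesis using \<open>p mod 8 \<in> _ \<longleftrightarrow> _\<close> by simp
    next
      case 3
      then have "h - h div 2 = 2 * j + 1" "2 * h + 1 = 8 * j + 5" by presburger+
      then show ?thesis using \<open>p mod 8 \<in> _ \<longleftrightarrow> _\<close> by simp
    next
      case 4
      then have "h - h div 2 = 2 * j + 2" "2 * h + 1 = 8 * j + 7" by presburger+
      then show ?thesis using \<open>p mod 8 \<in> _ \<longleftrightarrow> _\<close> by simp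
    qed
  qed
  finally show ?thesis unfolding L minus_one_power_iff by simp
qed

text \<open>For an odd prime \<open>p\<close> this is the prime discriminant, the one of
  \<open>p\<close> and \<open>-p\<close> that is 1 modulo 4.\<close>

definition prime_star :: "nat \<Rightarrow> int" where
  "prime_star p = (-1) ^ ((p - 1) div 2) * int p"

text \<open>The sign in the reciprocity law is the symbol of \<open>(-1) ^ ((p - 1) div 2)\<close>
  modulo \<open>q\<close>, so the sign built into \<open>prime_star\<close> absorbs it. For
  \<open>p = q\<close> both sides are 0.\<close>

lemma Legendre_prime_star:
  assumes "prime p" "2 < p" "prime q" "2 < q"
  shows "Legendre (prime_star p) (int q) = Legendre (int q) (int p)"
proof (cases "p = q")
  case True
  then show ?thesis by (simp add: Legendre_def prime_star_def cong_0_iff)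
next
  case False
  have pow: "Legendre ((-1) ^ k) (int q) = ((-1) ^ ((q - 1) div 2)) ^ k" for k
  proof (induction k)
    case (Suc k)
    then show ?case
      using Legendre_mult[OF assms(3,4), of "-1" "(-1) ^ k"] Legendre_minus_one[OF assms(3,4)] by simp
  qed (simp add: Legendre_one assms)
  have QR: "Legendre (int p) (int q) * Legendre (int q) (int p) = (-1) ^ ((p - 1) div 2 * ((q - 1) div 2))"
    using Quadratic_Reciprocity assms False by blast
  \<comment> \<open>The product in \<open>QR\<close> is a sign, so neither of its factors can be
    0.\<close>
  have sq: "Legendre (int p) (int q) * Legendre (int p) (int q) = 1"
    using QR by (auto simp: Legendre_def minus_one_power_iff split: if_splits)
  have "Legendre (prime_star p) (int q) = (-1) ^ ((p - 1) div 2 * ((q - 1) div 2)) * Legendre (int p) (int q)"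
    unfolding prime_star_def Legendre_mult[OF assms(3,4)] pow
    by (simp add: power_mult[symmetric] mult.commute)
  also have "\<dots> = Legendre (int q) (int p)"
    unfolding QR[symmetric] using sq by (simp add: mult.commute mult.left_commute)
  finally show ?thesis .
qed

section \<open>Kronecker symbols as periodic functions of definite parity\<close>

lemma kronecker_conv_prod_mset:
  "n > 0 \<Longrightarrow> kronecker a n = prod_mset (image_mset (kronecker_prime a) (prime_factorization n))"
  by (auto simp: kronecker_def image_prod_mset_multiplicity count_prime_factorization intro!: prod.cong)

text \<open>Completely multiplicative functions agree once they agree at primes. This is how the
  Kronecker symbol is identified with an explicit periodic function.\<close>

lemma kronecker_eq_completely_mult:
  assumes "h 1 = 1" "\<And>m n. h (m * n) = h m * h n"
    and "\<And>p. prime p \<Longrightarrow> kronecker_prime a p = h p" and "n > 0"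
  shows "kronecker a n = h n"
proof -
  have *: "prod_mset (image_mset h M) = h (prod_mset M)" for M
    by (induction M) (use assms(1,2) in simp_all)
  have "kronecker a n = prod_mset (image_mset h (prime_factorization n))"
    unfolding kronecker_conv_prod_mset[OF assms(4)]
    by (intro arg_cong[of _ _ prod_mset] image_mset_cong) (simp add: assms in_prime_factors_iff)
  then show ?thesis unfolding * using assms(4) by (simp add: prod_mset_prime_factorization_nat)
qed

text \<open>It suffices to check one prime at a time: odd primes reduce to the Legendre symbol, and
  the prime 2 to a finite check of odd residues modulo 8.\<close>

lemma kronecker_mult_left:
  assumes "n > 0"
  shows "kronecker (a * b) n = kronecker a n * kronecker b n"
proof -
  have two: "kronecker_prime (a * b) 2 = kronecker_prime a 2 * kronecker_prime b 2"
  proof -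
    have r: "x mod 8 \<in> {1,3,5,7}" if "odd x" for x :: int
      using that by simp presburger
    have m: "(a * b) mod 8 = ((a mod 8) * (b mod 8)) mod 8" by (simp add: mod_mult_eq)
    show ?thesis
    proof (cases "even a \<or> even b")
      case False
      then show ?thesis
        unfolding kronecker_prime_def m using r[of a] r[of b] by auto
    qed (auto simp: kronecker_prime_def)
  qed
  have "kronecker_prime (a * b) p = kronecker_prime a p * kronecker_prime b p" if "prime p" for p
  proof (cases "p = 2")
    case False
    then have "2 < p" using prime_ge_2_nat[OF that] by simp
    with False show ?thesis using that by (simp add: kronecker_prime_def Legendre_mult)
  qed (use two in simp)
  then show ?thesis unfolding kronecker_conv_prod_mset[OF assms] prod_mset.distrib[symmetric]
    by (intro arg_cong[of _ _ prod_mset] image_mset_cong) (simp add: in_prime_factors_iff)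
qed

text \<open>The function lives on all integers because parity makes no sense for the symbol at
  natural numbers. Period and parity are stated in terms of \<open>D\<close> so that the property
  passes to products.\<close>

definition kronecker_extends :: "int \<Rightarrow> (int \<Rightarrow> int) \<Rightarrow> bool" where
  "kronecker_extends D g \<longleftrightarrow> (\<forall>n>0. kronecker D n = g (int n)) \<and>
     (\<forall>x. g (x + \<bar>D\<bar>) = g x) \<and> (\<forall>x. g (- x) = sgn D * g x)"

lemma periodic_add_multiple:
  fixes g :: "int \<Rightarrow> 'b"
  assumes "\<And>x. g (x + d) = g x"
  shows "g (x + int k * d) = g x"
proof (induction k)
  case (Suc k)
  have "g (x + int (Suc k) * d) = g ((x + int k * d) + d)" by (simp add: algebra_simps)
  with Suc assms show ?case by simp
qed simp

text \<open>The modulus of \<open>D * D'\<close> is a multiple of both periods, and the parity signs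
  multiply.\<close>

lemma kronecker_extends_mult:
  assumes "kronecker_extends D g" "kronecker_extends D' g'"
  shows "kronecker_extends (D * D') (\<lambda>x. g x * g' x)"
proof -
  have "g (x + \<bar>D * D'\<bar>) = g x" for x
    using periodic_add_multiple[of g "\<bar>D\<bar>" x "nat \<bar>D'\<bar>"] assms
    by (simp add: kronecker_extends_def abs_mult mult.commute)
  moreover have "g' (x + \<bar>D * D'\<bar>) = g' x" for x
    using periodic_add_multiple[of g' "\<bar>D'\<bar>" x "nat \<bar>D\<bar>"] assms
    by (simp add: kronecker_extends_def abs_mult)
  ultimately show ?thesis
    using assms by (auto simp: kronecker_extends_def kronecker_mult_left sgn_mult)
qed

lemma kronecker_extends_one: "kronecker_extends 1 (\<lambda>_. 1)"
proof -
  have "kronecker 1 n = 1" if "n > 0" for n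
    by (rule kronecker_eq_completely_mult[where h = "\<lambda>_. 1"])
       (use that in \<open>auto simp: kronecker_prime_def Legendre_one prime_nat_iff\<close>)
  then show ?thesis by (simp add: kronecker_extends_def)
qed

text \<open>Values at odd primes come from reciprocity, the value at 2 from the second supplementary
  law, and the parity from the first, since \<open>(-1) ^ ((p - 1) div 2)\<close> is the sign of
  \<open>prime_star p\<close>.\<close>

lemma kronecker_extends_prime_star:
  assumes "prime p" "2 < p"
  shows "kronecker_extends (prime_star p) (\<lambda>x. Legendre x (int p))"
proof -
  have odd: "odd p" using assms prime_odd_nat by blast
  have "kronecker_prime (prime_star p) q = Legendre (int q) (int p)" if "prime q" for q
  proof (cases "q = 2")
    case True
    have "prime_star p mod 8 \<in> {1, 7} \<longleftrightarrow> p mod 8 \<in> {1, 7}"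
    proof -
      have p8: "int p mod 8 = int (p mod 8)" by (simp add: zmod_int)
      have "p mod 8 \<in> {1, 3, 5, 7}" using odd by simp presburger
      then have "(- int p) mod 8 \<in> {1, 7} \<longleftrightarrow> p mod 8 \<in> {1, 7}"
        using mod_minus_eq[of "int p" 8] p8 by auto
      moreover have "int p mod 8 \<in> {1, 7} \<longleftrightarrow> p mod 8 \<in> {1, 7}" using p8 by auto
      ultimately show ?thesis by (auto simp: prime_star_def minus_one_power_iff)
    qed
    moreover have "odd (prime_star p)" using odd by (simp add: prime_star_def)
    ultimately show ?thesis using True Legendre_two[OF assms] by (simp add: kronecker_prime_def)
  next
    case False
    then have "2 < q" using prime_ge_2_nat[OF that] by simp
    then show ?thesis using Legendre_prime_star assms that by (simp add: kronecker_prime_def)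
  qed
  then have "kronecker (prime_star p) n = Legendre (int n) (int p)" if "n > 0" for n
    using that Legendre_one[OF assms] Legendre_mult[OF assms]
    by (intro kronecker_eq_completely_mult[where h = "\<lambda>n. Legendre (int n) (int p)"]) auto
  moreover have "\<bar>prime_star p\<bar> = int p" by (simp add: prime_star_def abs_mult)
  moreover have "Legendre (x + int p) (int p) = Legendre x (int p)" for x
    by (rule Legendre_cong) (simp add: cong_def)
  moreover have "Legendre (- x) (int p) = sgn (prime_star p) * Legendre x (int p)" for x
    using Legendre_mult[OF assms, of "-1" x] Legendre_minus_one[OF assms] assms(2)
    by (auto simp: prime_star_def sgn_mult minus_one_power_iff)
  ultimately show ?thesis by (simp add: kronecker_extends_def)
qed

lemma int_mod_8_cases: "(x::int) mod 8 \<in> {0,1,2,3,4,5,6,7}"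
proof -
  have "r \<in> {0,1,2,3,4,5,6,7}" if "0 \<le> r" "r < 8" for r :: int
    using that by simp presburger
  then show ?thesis by (meson pos_mod_bound pos_mod_sign zero_less_numeral)
qed

text \<open>For the discriminants -4, 8 and -8 everything reduces to a table of residues modulo 8.
  The extra condition on \<open>h\<close> for modulus 4 says that this table already has period
  4.\<close>

lemma kronecker_extends_mod_8I:
  assumes D: "\<bar>D\<bar> = 8 \<or> \<bar>D\<bar> = 4 \<and> (\<forall>r\<in>{0..<4}. h (r + 4) = h r)"
    and h1: "h 1 = 1"
    and hm: "\<forall>x\<in>{0,1,2,3,4,5,6,7}. \<forall>y\<in>{0,1,2,3,4,5,6,7}. h ((x * y) mod 8) = h x * h y"
    and hneg: "\<forall>x\<in>{0,1,2,3,4,5,6,7}. h ((- x) mod 8) = sgn D * h x"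
    and hp: "h 2 = 0" "\<And>p. prime p \<Longrightarrow> 2 < p \<Longrightarrow> Legendre D (int p) = h (int p mod 8)"
  shows "kronecker_extends D (\<lambda>x. h (x mod 8))"
proof -
  have "\<bar>D\<bar> = 8 \<or> \<bar>D\<bar> = 4" using D by blast
  then have "even D" by presburger
  then have "kronecker_prime D p = h (int p mod 8)" if "prime p" for p
    using that hp prime_ge_2_nat[OF that] by (cases "p = 2") (auto simp: kronecker_prime_def)
  moreover have "h (int (m * n) mod 8) = h (int m mod 8) * h (int n mod 8)" for m n
    using bspec[OF bspec[OF hm int_mod_8_cases[of "int m"]] int_mod_8_cases[of "int n"]]
    by (simp add: mod_mult_eq)
  ultimately have "kronecker D n = h (int n mod 8)" if "n > 0" for n
    using that h1 by (intro kronecker_eq_completely_mult[where h = "\<lambda>n. h (int n mod 8)"]) auto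
  moreover have "h ((x + \<bar>D\<bar>) mod 8) = h (x mod 8)" for x
  proof (cases "\<bar>D\<bar> = 8")
    case False
    then have D4: "\<bar>D\<bar> = 4" and h4: "\<And>r. r \<in> {0..<4} \<Longrightarrow> h (r + 4) = h r"
      using D by auto
    show ?thesis
    proof (cases "x mod 8 < 4")
      case True
      have "(x + 4) mod 8 = x mod 8 + 4" using True by presburger
      then show ?thesis using h4[of "x mod 8"] True by (simp add: D4)
    next
      case False
      have "x mod 8 = (x + 4) mod 8 + 4" "(x + 4) mod 8 < 4" using False by presburger+
      then show ?thesis using h4[of "(x + 4) mod 8"] by (simp add: D4)
    qed
  qed simp
  moreover have "h ((- x) mod 8) = sgn D * h (x mod 8)" for x
    using bspec[OF hneg int_mod_8_cases[of x]] by (simp add: mod_minus_eq)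
  ultimately show ?thesis by (simp add: kronecker_extends_def)
qed

lemma Legendre_sq_mult:
  assumes "prime p" "2 < p" "\<not> int p dvd c"
  shows "Legendre (c * c * a) (int p) = Legendre a (int p)"
proof -
  have "Legendre c (int p) * Legendre c (int p) = 1"
    using assms(3) by (auto simp: Legendre_def cong_0_iff)
  then show ?thesis by (simp add: Legendre_mult[OF assms(1,2)])
qed

lemma odd_prime_not_dvd_two:
  assumes "2 < p" shows "\<not> int p dvd 2"
  using assms zdvd_not_zless[of 2 "int p"] by auto

lemma odd_mod_8_cases:
  fixes p :: nat
  assumes "odd p"
  obtains "p mod 8 = 1" "int p mod 8 = 1" "even ((p - 1) div 2)"
    | "p mod 8 = 3" "int p mod 8 = 3" "odd ((p - 1) div 2)"
    | "p mod 8 = 5" "int p mod 8 = 5" "even ((p - 1) div 2)"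
    | "p mod 8 = 7" "int p mod 8 = 7" "odd ((p - 1) div 2)"
proof -
  define k where "k = p div 8"
  have p: "p = 8 * k + p mod 8" by (simp add: k_def)
  have i: "int p mod 8 = int (p mod 8)" by (simp add: zmod_int)
  have "p mod 8 \<in> {1, 3, 5, 7}" using assms by simp presburger
  then consider "p mod 8 = 1" | "p mod 8 = 3" | "p mod 8 = 5" | "p mod 8 = 7" by auto
  then show ?thesis
  proof cases
    case 1
    then have "(p - 1) div 2 = 4 * k" using p by presburger
    with 1 i that(1) show ?thesis by simp
  next
    case 2
    then have "(p - 1) div 2 = 4 * k + 1" using p by presburger
    with 2 i that(2) show ?thesis by simp
  next
    case 3
    then have "(p - 1) div 2 = 4 * k + 2" using p by presburger
    with 3 i that(3) show ?thesis by simp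
  next
    case 4
    then have "(p - 1) div 2 = 4 * k + 3" using p by presburger
    with 4 i that(4) show ?thesis by simp
  qed
qed

lemma kronecker_extends_minus_4: "\<exists>g. kronecker_extends (-4) g"
proof -
  have "kronecker_extends (-4) (\<lambda>x. (\<lambda>r::int. if even r then 0 else if r mod 4 = 1 then 1 else -1) (x mod 8))"
  proof (rule kronecker_extends_mod_8I)
    fix p :: nat assume p: "prime p" "2 < p"
    have "odd p" using p prime_odd_nat by blast
    have "Legendre (-4) (int p) = (-1) ^ ((p - 1) div 2)"
      using Legendre_sq_mult[OF p odd_prime_not_dvd_two[OF p(2)], of "-1"] Legendre_minus_one[OF p]
      by simp
    then show "Legendre (-4) (int p) = (if even (int p mod 8) then 0 else if int p mod 8 mod 4 = 1 then 1 else -1)"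
      unfolding minus_one_power_iff by (cases rule: odd_mod_8_cases[OF \<open>odd p\<close>]) simp_all
  qed (auto simp: atLeastLessThan_def)
  then show ?thesis by blast
qed

lemma kronecker_extends_8: "\<exists>g. kronecker_extends 8 g"
proof -
  have "kronecker_extends 8 (\<lambda>x. (\<lambda>r::int. if even r then 0 else if r = 1 \<or> r = 7 then 1 else -1) (x mod 8))"
  proof (rule kronecker_extends_mod_8I)
    fix p :: nat assume p: "prime p" "2 < p"
    have "odd p" using p prime_odd_nat by blast
    have "Legendre 8 (int p) = Legendre 2 (int p)"
      using Legendre_sq_mult[OF p odd_prime_not_dvd_two[OF p(2)], of 2] by simp
    then show "Legendre 8 (int p) = (if even (int p mod 8) then 0 else if int p mod 8 = 1 \<or> int p mod 8 = 7 then 1 else -1)"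
      unfolding Legendre_two[OF p] by (cases rule: odd_mod_8_cases[OF \<open>odd p\<close>]) simp_all
  qed auto
  then show ?thesis by blast
qed

lemma kronecker_extends_minus_8: "\<exists>g. kronecker_extends (-8) g"
proof -
  have "kronecker_extends (-8) (\<lambda>x. (\<lambda>r::int. if even r then 0 else if r = 1 \<or> r = 3 then 1 else -1) (x mod 8))"
  proof (rule kronecker_extends_mod_8I)
    fix p :: nat assume p: "prime p" "2 < p"
    have "odd p" using p prime_odd_nat by blast
    have "Legendre (-8) (int p) = Legendre (-1) (int p) * Legendre 2 (int p)"
      using Legendre_sq_mult[OF p odd_prime_not_dvd_two[OF p(2)], of "-2"]
        Legendre_mult[OF p, of "-1" 2] by simp
    then show "Legendre (-8) (int p) = (if even (int p mod 8) then 0 else if int p mod 8 = 1 \<or> int p mod 8 = 3 then 1 else -1)"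
      unfolding Legendre_two[OF p] Legendre_minus_one[OF p] minus_one_power_iff
      by (cases rule: odd_mod_8_cases[OF \<open>odd p\<close>]) simp_all
  qed auto
  then show ?thesis by blast
qed

text \<open>Induction on the size of \<open>D\<close>: split off \<open>prime_star p\<close> for a
  prime divisor \<open>p\<close>. As \<open>prime_star p\<close> is 1 modulo 4, the cofactor is
  again 1 modulo 4 and squarefree. The process ends at 1, because -1 is 3 modulo 4.\<close>

lemma kronecker_extends_odd:
  assumes "squarefree D" "D mod 4 = 1"
  shows "\<exists>g. kronecker_extends D g"
  using assms
proof (induction "nat \<bar>D\<bar>" arbitrary: D rule: less_induct)
  case less
  show ?case
  proof (cases "\<bar>D\<bar> = 1")
    case True
    then have "D = 1" using less.prems by (auto simp: abs_eq_iff')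
    then show ?thesis using kronecker_extends_one by blast
  next
    case False
    then have "nat \<bar>D\<bar> \<noteq> 1" by auto
    then obtain p where p: "prime p" "p dvd nat \<bar>D\<bar>" using prime_factor_nat by blast
    have dvd: "int p dvd D" using p(2) by (simp add: int_dvd_int_iff[symmetric])
    have "odd D" using less.prems(2) by presburger
    then have odd: "odd p" using dvd by (metis dvd_trans even_of_nat_iff)
    then have p2: "2 < p" using prime_ge_2_nat[OF p(1)] by (cases "p = 2") auto
    have "prime_star p dvd D" using dvd by (auto simp: prime_star_def minus_one_power_iff)
    then obtain D' where D': "D = prime_star p * D'" by auto
    have star4: "prime_star p mod 4 = 1"
    proof -
      have a: "int p mod 4 = int p mod 8 mod 4" by (simp add: mod_mod_cancel)
      have b: "(- int p) mod 4 = (- (int p mod 8)) mod 4" by (metis mod_minus_eq a)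
      show ?thesis
        using odd
      proof (cases rule: odd_mod_8_cases)
        case 1
        have "int p mod 4 = 1 mod 4" unfolding a 1 ..
        then show ?thesis using 1 by (simp add: prime_star_def)
      next
        case 2
        have "(- int p) mod 4 = (- 3) mod 4" unfolding b 2 ..
        then show ?thesis using 2 by (simp add: prime_star_def)
      next
        case 3
        have "int p mod 4 = 5 mod 4" unfolding a 3 ..
        then show ?thesis using 3 by (simp add: prime_star_def)
      next
        case 4
        have "(- int p) mod 4 = (- 7) mod 4" unfolding b 4 ..
        then show ?thesis using 4 by (simp add: prime_star_def)
      qed
    qed
    have "D' mod 4 = 1"
    proof -
      have "D mod 4 = (prime_star p mod 4 * D') mod 4" unfolding D' by (simp add: mod_mult_left_eq)
      then show ?thesis using star4 less.prems(2) by simp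
    qed
    moreover have "squarefree D'" using less.prems(1) unfolding D' by (rule squarefree_multD)
    moreover have "nat \<bar>D'\<bar> < nat \<bar>D\<bar>"
    proof -
      have "D' \<noteq> 0" using less.prems(2) D' by auto
      then have "\<bar>D'\<bar> * 1 < \<bar>D'\<bar> * int p" using p2 by (intro mult_strict_left_mono) auto
      then show ?thesis unfolding D' by (simp add: prime_star_def abs_mult mult.commute)
    qed
    ultimately obtain g where "kronecker_extends D' g" using less.hyps by blast
    then show ?thesis unfolding D'
      using kronecker_extends_mult[OF kronecker_extends_prime_star[OF p(1) p2]] by blast
  qed
qed

text \<open>An even discriminant \<open>4 * m\<close> is \<open>(-4) * (- m)\<close> for
  \<open>m\<close> odd, and \<open>8 * k\<close> or \<open>(-8) * (- k)\<close> for
  \<open>m = 2 * k\<close>, where the choice makes the odd cofactor 1 modulo 4.\<close>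

lemma fundamental_kronecker_extends:
  assumes "fundamental_discriminant D"
  shows "\<exists>g. kronecker_extends D g"
proof -
  have mult: "\<exists>g. kronecker_extends (a * b) g"
    if "\<exists>g. kronecker_extends a g" "\<exists>g. kronecker_extends b g" for a b
    using that kronecker_extends_mult by blast
  from assms consider "D mod 4 = 1" "squarefree D"
    | m where "D = 4 * m" "squarefree m" "m mod 4 = 3"
    | m where "D = 4 * m" "squarefree m" "m mod 4 = 2"
    unfolding fundamental_discriminant_def
    by (metis dvd_mult_div_cancel insertE mod_0_imp_dvd singletonD)
  then show ?thesis
  proof cases
    case 1
    then show ?thesis using kronecker_extends_odd by blast
  next
    case 2
    have "(- m) mod 4 = 1" using 2(3) by presburger
    then have "\<exists>g. kronecker_extends (- m) g"
      using kronecker_extends_odd[of "- m"] 2(2) by simp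
    then show ?thesis using mult[OF kronecker_extends_minus_4] 2(1) by fastforce
  next
    case 3
    then have "even m" by presburger
    then obtain k where k: "m = 2 * k" by blast
    have "squarefree k" using 3(2) unfolding k by (rule squarefree_multD)
    moreover have "k mod 4 = 1 \<or> (- k) mod 4 = 1" using 3(3) unfolding k by presburger
    ultimately have "(\<exists>g. kronecker_extends k g) \<or> (\<exists>g. kronecker_extends (- k) g)"
      using kronecker_extends_odd[of k] kronecker_extends_odd[of "- k"] by auto
    then show ?thesis
      using mult[OF kronecker_extends_8, of k] mult[OF kronecker_extends_minus_8, of "- k"] 3(1) k
      by fastforce
  qed
qed

subsection \<open>Analytic continuation by iterated summation by parts\<close>

text \<open>With \<open>T\<close> the shift by 1 this is \<open>(1 - T) ^ k\<close> applied to
  \<open>F\<close>, that is, the iterated forward difference up to the sign \<open>(-1) ^ k\<close>.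
  This sign is the one that summation by parts produces.\<close>

primrec fdiff :: "nat \<Rightarrow> (complex \<Rightarrow> complex) \<Rightarrow> complex \<Rightarrow> complex" where
  "fdiff 0 F z = F z"
| "fdiff (Suc k) F z = fdiff k F z - fdiff k F (z + 1)"

lemma periodic_mult_add:
  fixes g :: "nat \<Rightarrow> 'a"
  assumes "\<And>n. g (n + f) = g n"
  shows "g (n + m * f) = g n"
proof (induction m)
  case (Suc m)
  have "g (n + Suc m * f) = g ((n + m * f) + f)" by (simp add: algebra_simps)
  then show ?case using Suc assms by simp
qed simp

lemma periodic_bounded:
  fixes g :: "nat \<Rightarrow> complex"
  assumes "\<And>n. g (n + f) = g n" "f > 0"
  obtains B where "\<And>n. norm (g n) \<le> B"
proof
  fix n
  have "g n = g (n mod f + (n div f) * f)" by simp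
  also have "\<dots> = g (n mod f)" by (rule periodic_mult_add) (rule assms(1))
  finally have "norm (g n) = norm (g (n mod f))" by simp
  also have "\<dots> \<le> (\<Sum>i<f. norm (g i))"
    by (rule member_le_sum) (use assms(2) in auto)
  finally show "norm (g n) \<le> (\<Sum>i<f. norm (g i))" .
qed

lemma sum_blocks:
  fixes F :: "nat \<Rightarrow> 'a::comm_monoid_add"
  shows "(\<Sum>n<M * f. F n) = (\<Sum>m<M. \<Sum>u<f. F (m * f + u))"
proof -
  have "sum F {m * f..<m * f + f} = (\<Sum>u<f. F (m * f + u))" for m
    using sum.shift_bounds_nat_ivl[of F 0 "m * f" f] by (simp add: lessThan_atLeast0 add.commute)
  then show ?thesis by (simp add: sum.nat_group[symmetric])
qed

text \<open>Partial sums of a mean-zero periodic sequence are periodic. Subtracting their mean makes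
  them mean-zero as well, which permits iteration. The constant \<open>c\<close> stands for the
  value of \<open>h\<close> at index -1.\<close>

lemma periodic_antidifference:
  fixes g :: "nat \<Rightarrow> complex"
  assumes per: "\<And>n. g (n + f) = g n" and f: "f > 0" and mean: "(\<Sum>n<f. g n) = 0"
  obtains h c where "\<And>n. h (n + f) = h n" "(\<Sum>n<f. h n) = 0"
    "\<And>n. g (Suc n) = h (Suc n) - h n" "g 0 = h 0 - c" "h (f - 1) = c"
proof -
  define S where "S n = (\<Sum>i<Suc n. g i)" for n
  define d where "d = (\<Sum>n<f. S n) / of_nat f"
  have shift: "(\<Sum>i<n + f. g i) = (\<Sum>i<n. g i)" for n
    by (induction n) (simp_all add: mean per)
  show ?thesis
  proof
    show "(S (n + f) - d) = S n - d" for n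
      unfolding S_def using shift[of "Suc n"] by simp
    show "(\<Sum>n<f. S n - d) = 0"
      using f by (simp add: sum_subtractf d_def)
    show "g (Suc n) = (S (Suc n) - d) - (S n - d)" for n
      by (simp add: S_def)
    show "g 0 = (S 0 - d) - (- d)" by (simp add: S_def)
    show "S (f - 1) - d = - d" using f mean by (simp add: S_def)
  qed
qed

lemma summation_by_parts_step:
  fixes g h :: "nat \<Rightarrow> complex"
  assumes "\<And>n. g (Suc n) = h (Suc n) - h n" "g 0 = h 0 - c"
  shows "(\<Sum>n<Suc N. g n * F (of_nat (Suc n))) =
    (\<Sum>n<Suc N. h n * (F (of_nat (Suc n)) - F (of_nat (Suc n) + 1)))
      + h N * F (of_nat (Suc N) + 1) - c * F 1"
proof (induction N)
  case (Suc N)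
  have "(\<Sum>n<Suc (Suc N). g n * F (of_nat (Suc n))) =
     (\<Sum>n<Suc N. g n * F (of_nat (Suc n))) + g (Suc N) * F (of_nat (Suc (Suc N)))"
    by simp
  also have "\<dots> = (\<Sum>n<Suc N. h n * (F (of_nat (Suc n)) - F (of_nat (Suc n) + 1)))
      + h N * F (of_nat (Suc N) + 1) - c * F 1 + (h (Suc N) - h N) * F (of_nat (Suc (Suc N)))"
    unfolding Suc.IH assms(1) ..
  finally have "(\<Sum>n<Suc (Suc N). g n * F (of_nat (Suc n))) = \<dots>" .
  then show ?case by (simp add: algebra_simps)
qed (simp add: assms algebra_simps)

text \<open>The sums run over full periods, so that the boundary terms at both ends carry the same
  coefficient. Both \<open>h\<close> and \<open>c\<close> are chosen before \<open>F\<close>, so one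
  identity serves a power of \<open>n\<close> as well as its derivative in the exponent.\<close>

lemma iterated_summation_by_parts:
  fixes g :: "nat \<Rightarrow> complex"
  assumes per: "\<And>n. g (n + f) = g n" and f: "f > 0" and mean: "(\<Sum>n<f. g n) = 0"
  shows "\<exists>h c. (\<forall>n. h (n + f) = h n) \<and> (\<Sum>n<f. h n) = 0 \<and>
    (\<forall>F M. (\<Sum>n<M * f. g n * F (of_nat (Suc n))) =
       (\<Sum>n<M * f. h n * fdiff k F (of_nat (Suc n)))
       + (\<Sum>j<k. c j * (fdiff j F (of_nat (M * f) + 1) - fdiff j F 1)))"
proof (induction k)
  case 0
  show ?case by (rule exI[of _ g]) (use assms in auto)
next
  case (Suc k)
  then obtain h c where h: "\<And>n. h (n + f) = h n" "(\<Sum>n<f. h n) = 0"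
    and eq: "\<And>F M. (\<Sum>n<M * f. g n * F (of_nat (Suc n))) =
       (\<Sum>n<M * f. h n * fdiff k F (of_nat (Suc n)))
       + (\<Sum>j<k. c j * (fdiff j F (of_nat (M * f) + 1) - fdiff j F 1))" by blast
  obtain h' d where h': "\<And>n. h' (n + f) = h' n" "(\<Sum>n<f. h' n) = 0"
    "\<And>n. h (Suc n) = h' (Suc n) - h' n" "h 0 = h' 0 - d" "h' (f - 1) = d"
    using periodic_antidifference[of h f, OF h(1) f h(2)] by blast
  define c' where "c' = c(k := d)"
  have "(\<Sum>n<M * f. g n * F (of_nat (Suc n))) =
       (\<Sum>n<M * f. h' n * fdiff (Suc k) F (of_nat (Suc n)))
       + (\<Sum>j<Suc k. c' j * (fdiff j F (of_nat (M * f) + 1) - fdiff j F 1))" for F M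
  proof (cases M)
    case 0
    then show ?thesis by simp
  next
    case (Suc m)
    \<comment> \<open>The last index of the last period, where \<open>h'\<close> takes the value
      \<open>d\<close> that it would have at index -1.\<close>
    define N where "N = M * f - 1"
    have N: "M * f = Suc N" using Suc f by (simp add: N_def)
    have "h' N = h' ((f - 1) + m * f)"
      unfolding N_def Suc using f by (intro arg_cong[of _ _ h']) simp
    also have "\<dots> = d" using periodic_mult_add[of h' f, OF h'(1)] h'(5) by metis
    finally have hN: "h' N = d" .
    have "(\<Sum>n<Suc N. h n * fdiff k F (of_nat (Suc n))) =
      (\<Sum>n<Suc N. h' n * fdiff (Suc k) F (of_nat (Suc n)))
        + d * (fdiff k F (of_nat (Suc N) + 1) - fdiff k F 1)"
      using summation_by_parts_step[of h h' d "fdiff k F" N, OF h'(3,4)] hN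
      by (simp add: algebra_simps)
    moreover have "(\<Sum>j<k. c' j * X j) = (\<Sum>j<k. c j * X j)" for X
      by (intro sum.cong) (auto simp: c'_def)
    ultimately show ?thesis
      unfolding eq[of F M] unfolding N by (simp add: c'_def)
  qed
  then show ?case using h' by blast
qed

section \<open>Decay and differentiability of the differences of a power\<close>

definition npow :: "complex \<Rightarrow> complex \<Rightarrow> complex" where
  "npow s z = z powr (- s)"

lemma fdiff_npow_deriv:
  assumes "z \<notin> \<real>\<^sub>\<le>\<^sub>0"
  shows "(fdiff k (npow s) has_field_derivative - s * fdiff k (npow (s + 1)) z) (at z)"
  using assms
proof (induction k arbitrary: z)
  case 0
  show ?case unfolding fdiff.simps npow_def using 0
    by (auto intro!: derivative_eq_intros has_field_derivative_powr simp: fun_eq_iff)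
next
  case (Suc k)
  have "z + 1 \<notin> \<real>\<^sub>\<le>\<^sub>0"
    using Suc.prems by (auto simp: complex_nonpos_Reals_iff)
  then have "((\<lambda>z. fdiff k (npow s) (z + 1)) has_field_derivative - s * fdiff k (npow (s + 1)) (z + 1)) (at z)"
    using Suc.IH[of "z + 1"] by (simp add: DERIV_shift)
  from DERIV_diff[OF Suc.IH[OF Suc.prems] this]
  show ?case by (simp add: algebra_simps fdiff.simps(2)[abs_def])
qed

text \<open>Each difference is bounded by a derivative on a segment of length 1, which gives a
  factor \<open>s\<close> and replaces \<open>s\<close> by \<open>s + 1\<close>. The factors
  accumulate to the Pochhammer symbol, and \<open>k\<close> differences gain \<open>k\<close> powers
  of decay. The condition on \<open>Re s\<close> makes the bound largest at the left end of the
  segment.\<close>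

lemma fdiff_npow_bound:
  assumes "x > 0" "Re s + real k \<ge> 0"
  shows "norm (fdiff k (npow s) (of_real x)) \<le> norm (pochhammer s k) * x powr (- (Re s + real k))"
  using assms
proof (induction k arbitrary: s x)
  case 0
  then show ?case by (simp add: npow_def norm_powr_real_powr)
next
  case (Suc k)
  let ?S = "closed_segment (of_real x) (of_real (x + 1) :: complex)"
  let ?B = "norm s * (norm (pochhammer (s + 1) k) * x powr (- (Re s + real (Suc k))))"
  have "norm (fdiff k (npow s) (of_real x) - fdiff k (npow s) (of_real (x + 1))) \<le>
      ?B * norm (of_real x - of_real (x + 1) :: complex)"
  proof (rule field_differentiable_bound[of ?S])
    fix z assume "z \<in> ?S"
    then obtain u where "0 \<le> u" and u: "z = (1 - u) *\<^sub>R of_real x + u *\<^sub>R of_real (x + 1)"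
      by (auto simp: in_segment)
    define y where "y = x + u"
    have y: "z = of_real y" "x \<le> y"
      using u \<open>0 \<le> u\<close> by (simp_all add: y_def scaleR_conv_of_real algebra_simps)
    show "(fdiff k (npow s) has_field_derivative - s * fdiff k (npow (s + 1)) z) (at z within ?S)"
      using fdiff_npow_deriv[of z k s] Suc.prems y by (auto intro: has_field_derivative_at_within)
    have "norm (fdiff k (npow (s + 1)) (of_real y)) \<le>
        norm (pochhammer (s + 1) k) * y powr (- (Re (s + 1) + real k))"
      using Suc.IH[of y "s + 1"] Suc.prems y by (simp add: algebra_simps)
    also have "\<dots> \<le> norm (pochhammer (s + 1) k) * x powr (- (Re s + real (Suc k)))"
      using Suc.prems y by (intro mult_left_mono) (auto intro!: powr_mono2' simp: algebra_simps)
    finally show "norm (- s * fdiff k (npow (s + 1)) z) \<le> ?B"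
      unfolding norm_mult y by (simp add: mult_left_mono)
  qed auto
  also have "norm (of_real x - of_real (x + 1) :: complex) = 1" by simp
  finally show ?case
    by (simp add: pochhammer_rec norm_mult mult_ac)
qed

lemma fdiff_npow_has_deriv_exponent:
  assumes "z \<noteq> 0" "\<And>i::nat. z + of_nat i \<noteq> 0"
  shows "((\<lambda>s. fdiff k (npow s) z) has_field_derivative
     fdiff k (\<lambda>w. - Ln w * npow s w) z) (at s)"
  using assms
proof (induction k arbitrary: z)
  case 0
  then show ?case
    unfolding fdiff.simps npow_def by (auto intro!: derivative_eq_intros simp: powr_def)
next
  case (Suc k)
  have "z + 1 + of_nat i \<noteq> 0" for i
    using Suc.prems(2)[of "Suc i"] by (simp add: add_ac)
  then show ?case
    using Suc.prems(2)[of 1] Suc.prems unfolding fdiff.simps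
    by (intro DERIV_diff Suc.IH) auto
qed

lemma norm_pochhammer_le:
  fixes s :: complex
  assumes "norm s \<le> R"
  shows "norm (pochhammer s k) \<le> pochhammer R k"
proof (induction k)
  case (Suc k)
  have "norm (s + of_nat k) \<le> R + real k"
    using norm_triangle_ineq[of s "of_nat k"] assms by simp
  moreover have "0 \<le> R" using assms norm_ge_zero order_trans by blast
  ultimately show ?case
    unfolding pochhammer_Suc norm_mult using Suc order_trans[OF norm_ge_zero Suc.IH]
    by (intro mult_mono) auto
qed simp

text \<open>Weierstrass test on a disc whose radius \<open>d\<close> is half the distance from
  \<open>s0\<close> to the line \<open>Re s = 1 - k\<close>. There the \<open>n\<close>-th term is
  dominated by a constant times \<open>n\<close> to the power \<open>-(1 + d)\<close>.\<close>

lemma fdiff_npow_series_uniform_limit: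
  fixes h :: "nat \<Rightarrow> complex"
  assumes B: "\<And>n. norm (h n) \<le> B" and s0: "Re s0 > 1 - real k"
  shows "\<exists>d>0. cball s0 d \<subseteq> {s. Re s > 1 - real k} \<and>
    uniform_limit (cball s0 d) (\<lambda>N s. \<Sum>n<N. h n * fdiff k (npow s) (of_nat (Suc n)))
      (\<lambda>s. \<Sum>n. h n * fdiff k (npow s) (of_nat (Suc n))) sequentially"
proof -
  define d where "d = (Re s0 + real k - 1) / 2"
  define R where "R = norm s0 + d"
  have d: "d > 0" using s0 by (simp add: d_def)
  have Re: "Re s + real k \<ge> 1 + d" if "s \<in> cball s0 d" for s
  proof -
    have "\<bar>Re s0 - Re s\<bar> \<le> d"
      using that abs_Re_le_cmod[of "s0 - s"] by (simp add: dist_norm)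
    then show ?thesis unfolding d_def by argo
  qed
  have "cball s0 d \<subseteq> {s. Re s > 1 - real k}" using Re d by force
  moreover have "uniform_limit (cball s0 d) (\<lambda>N s. \<Sum>n<N. h n * fdiff k (npow s) (of_nat (Suc n)))
      (\<lambda>s. \<Sum>n. h n * fdiff k (npow s) (of_nat (Suc n))) sequentially"
  proof (rule Weierstrass_m_test)
    fix n s assume s: "s \<in> cball s0 d"
    have "norm s \<le> R" using s norm_triangle_ineq2[of s s0] by (simp add: R_def dist_norm norm_minus_commute)
    have "norm (fdiff k (npow s) (of_real (real (Suc n)))) \<le> norm (pochhammer s k) * real (Suc n) powr (- (Re s + real k))"
      using Re[OF s] d by (intro fdiff_npow_bound) auto
    also have "\<dots> \<le> pochhammer R k * real (Suc n) powr (- (1 + d))"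
      using Re[OF s] norm_pochhammer_le[OF \<open>norm s \<le> R\<close>, of k]
        order_trans[OF norm_ge_zero norm_pochhammer_le[OF \<open>norm s \<le> R\<close>, of k]]
      by (intro mult_mono) (auto intro!: powr_mono)
    finally show "norm (h n * fdiff k (npow s) (of_nat (Suc n))) \<le> B * (pochhammer R k * real (Suc n) powr (- (1 + d)))"
      unfolding norm_mult using B[of n] order_trans[OF norm_ge_zero B[of n]]
      by (intro mult_mono) auto
  next
    have "summable (\<lambda>n. real n powr (- (1 + d)))" using d by (subst summable_real_powr_iff) auto
    then show "summable (\<lambda>n. B * (pochhammer R k * real (Suc n) powr (- (1 + d))))"
      by (intro summable_mult) (subst summable_Suc_iff)
  qed
  ultimately show ?thesis using d by blast
qed

section \<open>Continuation of the Dirichlet series and its derivative at -1\<close>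

definition mean_zero_periodic :: "nat \<Rightarrow> (nat \<Rightarrow> complex) \<Rightarrow> bool" where
  "mean_zero_periodic f g \<longleftrightarrow> f > 0 \<and> (\<forall>n. g (n + f) = g n) \<and> (\<Sum>n<f. g n) = 0"

lemma of_nat_Suc_plus_neq_0: "of_nat (Suc n) + of_nat i \<noteq> (0 :: 'a :: semiring_char_0)"
proof -
  have "of_nat (Suc n) + of_nat i = (of_nat (Suc (n + i)) :: 'a)" by (simp add: add_ac)
  then show ?thesis by (simp only: of_nat_neq_0 not_False_eq_True)
qed

text \<open>After \<open>k\<close> summations by parts the remaining series converges locally
  uniformly for \<open>Re s > 1 - k\<close> and may be differentiated termwise. Undoing the
  summation by parts for the differentiated power yields the partial sums corrected by boundary
  terms.\<close>

lemma dirichlet_series_continuation_step: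
  assumes "mean_zero_periodic f g"
  shows "\<exists>E c. E holomorphic_on {s. Re s > 1 - real k} \<and>
    (\<forall>s. Re s > 1 \<longrightarrow> (\<lambda>n. g n * npow s (of_nat (Suc n))) sums E s) \<and>
    (\<forall>s. Re s > 1 - real k \<longrightarrow> (\<lambda>M. (\<Sum>n<M * f. g n * (- Ln (of_nat (Suc n)) * npow s (of_nat (Suc n))))
       - (\<Sum>j<k. c j * fdiff j (\<lambda>w. - Ln w * npow s w) (of_nat (M * f) + 1))) \<longlonglongrightarrow> deriv E s)"
proof -
  have f: "f > 0" and per: "\<And>n. g (n + f) = g n" and mean: "(\<Sum>n<f. g n) = 0"
    using assms by (auto simp: mean_zero_periodic_def)
  define H where "H = {s. Re s > 1 - real k}"
  have oH: "open H" unfolding H_def by (rule open_halfspace_Re_gt)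
  obtain h c where h: "\<And>n. h (n + f) = h n"
    and eq: "\<And>F M. (\<Sum>n<M * f. g n * F (of_nat (Suc n))) =
       (\<Sum>n<M * f. h n * fdiff k F (of_nat (Suc n)))
       + (\<Sum>j<k. c j * (fdiff j F (of_nat (M * f) + 1) - fdiff j F 1))"
    using iterated_summation_by_parts[of g f k, OF per f mean] by blast
  obtain B where B: "\<And>n. norm (h n) \<le> B" using periodic_bounded[of h f, OF h f] by blast
  obtain Bg where Bg: "\<And>n. norm (g n) \<le> Bg" using periodic_bounded[of g f, OF per f] by blast
  \<comment> \<open>The boundary terms at 1 do not depend on the length of the sum and become part
    of the continuation.\<close>
  define A where "A s = (\<Sum>j<k. c j * fdiff j (npow s) 1)" for s
  define T where "T N s = (\<Sum>n<N. h n * fdiff k (npow s) (of_nat (Suc n))) - A s" for N s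
  define E where "E s = (\<Sum>n. h n * fdiff k (npow s) (of_nat (Suc n))) - A s" for s
  define DA where "DA s = (\<Sum>j<k. c j * fdiff j (\<lambda>w. - Ln w * npow s w) 1)" for s
  define DT where "DT N s = (\<Sum>n<N. h n * fdiff k (\<lambda>w. - Ln w * npow s w) (of_nat (Suc n))) - DA s" for N s
  have unif: "\<exists>d>0. cball s d \<subseteq> H \<and> uniform_limit (cball s d) T E sequentially" if "s \<in> H" for s
    using fdiff_npow_series_uniform_limit[of h B k s, OF B] that
    unfolding H_def T_def E_def
    by (auto intro!: uniform_limit_intros)
  have DT: "(T N has_field_derivative DT N s) (at s)" for N s
  proof -
    have "1 + of_nat i \<noteq> (0::complex)" for i using of_nat_Suc_plus_neq_0[of 0 i] by simp
    then have "((\<lambda>s. fdiff j (npow s) 1) has_field_derivative fdiff j (\<lambda>w. - Ln w * npow s w) 1) (at s)" for j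
      by (intro fdiff_npow_has_deriv_exponent) auto
    moreover have "((\<lambda>s. fdiff k (npow s) (of_nat (Suc n))) has_field_derivative
        fdiff k (\<lambda>w. - Ln w * npow s w) (of_nat (Suc n))) (at s)" for n
      by (intro fdiff_npow_has_deriv_exponent of_nat_Suc_plus_neq_0) (metis of_nat_neq_0)
    ultimately show ?thesis
      unfolding T_def[abs_def] A_def DT_def DA_def
      by (intro DERIV_diff DERIV_sum DERIV_cmult) 
  qed
  obtain E' where E': "\<And>s. s \<in> H \<Longrightarrow> (E has_field_derivative E' s) (at s) \<and> (\<lambda>N. DT N s) \<longlonglongrightarrow> E' s"
    using has_complex_derivative_uniform_sequence[OF oH DT unif] by blast
  have hol: "E holomorphic_on H"
    using E' oH by (meson holomorphic_onI field_differentiable_def field_differentiable_at_within)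
  have sums: "(\<lambda>n. g n * npow s (of_nat (Suc n))) sums E s" if s: "Re s > 1" for s
  proof -
    have sub: "filterlim (\<lambda>M. M * f) at_top sequentially"
      using f by (auto intro: filterlim_subseq simp: strict_mono_def)
    have "summable (\<lambda>n. real n powr (- Re s))" using s by (subst summable_real_powr_iff) auto
    then have smB: "summable (\<lambda>n. Bg * real (Suc n) powr (- Re s))"
      by (intro summable_mult) (subst summable_Suc_iff)
    have le: "norm (g n * npow s (of_nat (Suc n))) \<le> Bg * real (Suc n) powr (- Re s)" for n
    proof -
      have "norm (npow s (of_nat (Suc n))) = real (Suc n) powr (- Re s)"
        unfolding npow_def by (subst norm_powr_real_powr) auto
      then show ?thesis unfolding norm_mult using Bg[of n] by (simp add: mult_right_mono)
    qed
    have sm: "summable (\<lambda>n. g n * npow s (of_nat (Suc n)))"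
      by (rule summable_comparison_test'[OF smB le])
    then have L: "(\<lambda>M. \<Sum>n<M * f. g n * npow s (of_nat (Suc n))) \<longlonglongrightarrow> (\<Sum>n. g n * npow s (of_nat (Suc n)))"
      using filterlim_compose[OF summable_LIMSEQ sub] by blast
    have "s \<in> H" using s by (simp add: H_def)
    then obtain d where "d > 0" "uniform_limit (cball s d) T E sequentially" using unif by blast
    then have "(\<lambda>N. T N s) \<longlonglongrightarrow> E s"
      by (metis tendsto_uniform_limitI centre_in_cball less_imp_le)
    then have T: "(\<lambda>M. T (M * f) s) \<longlonglongrightarrow> E s"
      by (rule filterlim_compose[OF _ sub])
    \<comment> \<open>In the half-plane of absolute convergence the upper boundary terms disappear
      in the limit, so \<open>E\<close> is the sum of the original series there.\<close>
    have van: "(\<lambda>N. fdiff j (npow s) (of_nat N + 1)) \<longlonglongrightarrow> 0" for j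
    proof (rule Lim_null_comparison)
      show "\<forall>\<^sub>F N in sequentially. norm (fdiff j (npow s) (of_nat N + 1)) \<le>
          norm (pochhammer s j) * (real N + 1) powr (- (Re s + real j))"
      proof (intro always_eventually allI)
        fix N
        show "norm (fdiff j (npow s) (of_nat N + 1)) \<le> norm (pochhammer s j) * (real N + 1) powr (- (Re s + real j))"
          using fdiff_npow_bound[of "real N + 1" s j] s by simp
      qed
      have "((\<lambda>N. (real N + 1) powr (- (Re s + real j))) \<longlongrightarrow> 0) sequentially"
        by (rule tendsto_neg_powr) (use s in \<open>simp, real_asymp\<close>)
      then show "(\<lambda>N. norm (pochhammer s j) * (real N + 1) powr (- (Re s + real j))) \<longlonglongrightarrow> 0"
        by (rule tendsto_mult_right_zero)
    qed
    have "(\<lambda>M. T (M * f) s + (\<Sum>j<k. c j * fdiff j (npow s) (of_nat (M * f) + 1))) \<longlonglongrightarrow> E s + (\<Sum>j<k. c j * 0)"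
      by (intro tendsto_add T tendsto_sum tendsto_mult tendsto_const filterlim_compose[OF van sub])
    also have "(\<lambda>M. T (M * f) s + (\<Sum>j<k. c j * fdiff j (npow s) (of_nat (M * f) + 1))) =
       (\<lambda>M. \<Sum>n<M * f. g n * npow s (of_nat (Suc n)))"
      unfolding eq[of "npow s"] T_def A_def by (auto simp: fun_eq_iff algebra_simps sum_subtractf)
    finally have "(\<Sum>n. g n * npow s (of_nat (Suc n))) = E s"
      using LIMSEQ_unique[OF L] by simp
    then show ?thesis using sm by (simp add: sums_iff)
  qed
  have "(\<lambda>M. (\<Sum>n<M * f. g n * (- Ln (of_nat (Suc n)) * npow s (of_nat (Suc n))))
       - (\<Sum>j<k. c j * fdiff j (\<lambda>w. - Ln w * npow s w) (of_nat (M * f) + 1))) \<longlonglongrightarrow> deriv E s"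
    if "s \<in> H" for s
  proof -
    have sub: "filterlim (\<lambda>M. M * f) at_top sequentially"
      using f by (auto intro: filterlim_subseq simp: strict_mono_def)
    have "(\<lambda>N. DT N s) \<longlonglongrightarrow> deriv E s"
      using E'[OF that] DERIV_imp_deriv by metis
    then have "(\<lambda>M. DT (M * f) s) \<longlonglongrightarrow> deriv E s"
      by (rule filterlim_compose[OF _ sub])
    also have "(\<lambda>M. DT (M * f) s) = (\<lambda>M. (\<Sum>n<M * f. g n * (- Ln (of_nat (Suc n)) * npow s (of_nat (Suc n))))
       - (\<Sum>j<k. c j * fdiff j (\<lambda>w. - Ln w * npow s w) (of_nat (M * f) + 1)))"
      unfolding eq[of "\<lambda>w. - Ln w * npow s w"] DT_def DA_def
      by (auto simp: fun_eq_iff algebra_simps sum_subtractf)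
    finally show ?thesis .
  qed
  then show ?thesis using hol sums unfolding H_def by blast
qed

lemma halfspace_continuation_unique:
  assumes "E holomorphic_on {s. Re s > a}" "F holomorphic_on {s. Re s > a}"
    and "\<And>s. Re s > 1 \<Longrightarrow> E s = F s" "a \<le> 1" "Re s > a"
  shows "E s = F s"
proof (rule analytic_continuation_open[of "{s. Re s > 1}" "{s. Re s > a}" E F])
  have "(2::complex) \<in> {s. Re s > 1}" by simp
  then show "{s. Re s > 1} \<noteq> ({} :: complex set)" by blast
  show "connected {s. Re s > a}" by (intro convex_connected convex_halfspace_Re_gt)
qed (use assms in \<open>auto intro: open_halfspace_Re_gt\<close>)

text \<open>The continuations for different \<open>k\<close> agree where they overlap, by the
  identity theorem, and glue to an entire function. It is the only one with the given Dirichlet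
  series, hence equals \<open>dirichlet_L\<close>. The point -1 lies in the half-plane
  \<open>Re s > 1 - k\<close> from \<open>k = 3\<close> on.\<close>

lemma dirichlet_L_mean_zero_periodic:
  assumes "mean_zero_periodic f (\<lambda>n. ch (Suc n))"
  shows "\<exists>c. (\<lambda>M. (\<Sum>n<M * f. ch (Suc n) * (- Ln (of_nat (Suc n)) * of_nat (Suc n)))
       - (\<Sum>j<3. c j * fdiff j (\<lambda>w. - Ln w * w) (of_nat (M * f) + 1))) \<longlonglongrightarrow> deriv (dirichlet_L ch) (-1)"
proof -
  define g where "g n = ch (Suc n)" for n
  define Q where "Q k E c \<longleftrightarrow> E holomorphic_on {s. Re s > 1 - real k} \<and>
    (\<forall>s. Re s > 1 \<longrightarrow> (\<lambda>n. g n * npow s (of_nat (Suc n))) sums E s) \<and>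
    (\<forall>s. Re s > 1 - real k \<longrightarrow> (\<lambda>M. (\<Sum>n<M * f. g n * (- Ln (of_nat (Suc n)) * npow s (of_nat (Suc n))))
       - (\<Sum>j<k. c j * fdiff j (\<lambda>w. - Ln w * npow s w) (of_nat (M * f) + 1))) \<longlonglongrightarrow> deriv E s)"
    for k E c
  have "\<forall>k. \<exists>E c. Q k E c"
    using dirichlet_series_continuation_step[OF assms] unfolding g_def Q_def by blast
  then obtain E c where Q: "\<And>k. Q k (E k) (c k)" by metis
  have hol: "E k holomorphic_on {s. Re s > 1 - real k}" for k
    using Q unfolding Q_def by blast
  have sums: "(\<lambda>n. g n * npow s (of_nat (Suc n))) sums E k s" if "Re s > 1" for k s
    using Q that unfolding Q_def by blast
  have lim: "(\<lambda>M. (\<Sum>n<M * f. g n * (- Ln (of_nat (Suc n)) * npow s (of_nat (Suc n))))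
       - (\<Sum>j<k. c k j * fdiff j (\<lambda>w. - Ln w * npow s w) (of_nat (M * f) + 1))) \<longlonglongrightarrow> deriv (E k) s"
    if "Re s > 1 - real k" for k s
    using Q that unfolding Q_def by blast
  \<comment> \<open>An index \<open>k\<close> of at least \<open>2 - Re s\<close> guarantees
    \<open>Re s > 1 - k\<close>.\<close>
  define L where "L s = E (nat \<lceil>2 - Re s\<rceil>) s" for s
  have L_eq: "L s = E k s" if "Re s > 1 - real k" for k s
  proof -
    define l where "l = nat \<lceil>2 - Re s\<rceil>"
    have l: "Re s > 1 - real l" unfolding l_def by linarith
    have "E l s = E k s"
    proof (rule halfspace_continuation_unique[of "E l" "1 - real (min k l)" "E k"])
      show "E l holomorphic_on {s. Re s > 1 - real (min k l)}"
        by (rule holomorphic_on_subset[OF hol[of l]]) auto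
      show "E k holomorphic_on {s. Re s > 1 - real (min k l)}"
        by (rule holomorphic_on_subset[OF hol[of k]]) auto
      show "E l s = E k s" if "Re s > 1" for s
        using sums_unique2[OF sums[OF that] sums[OF that]] .
    qed (use that l in auto)
    then show ?thesis by (simp add: L_def l_def)
  qed
  have nbhd: "\<forall>\<^sub>F w in nhds s. L w = E k w" if "Re s > 1 - real k" for k s
    using eventually_nhds_in_open[OF open_halfspace_Re_gt[of "1 - real k"], of s] that
    by (auto elim!: eventually_mono intro: L_eq)
  have "L field_differentiable at s" for s
  proof -
    define k where "k = nat \<lceil>2 - Re s\<rceil>"
    have k: "Re s > 1 - real k" unfolding k_def by linarith
    have "E k field_differentiable at s"
      using hol[of k] k open_halfspace_Re_gt holomorphic_on_imp_differentiable_at by blast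
    then show ?thesis
      unfolding field_differentiable_def DERIV_cong_ev[OF refl nbhd[OF k] refl] .
  qed
  then have Lhol: "L holomorphic_on UNIV" by (simp add: holomorphic_on_def)
  have conv: "ch (Suc n) / of_nat (Suc n) powr s = g n * npow s (of_nat (Suc n))" for n s
    by (simp add: g_def npow_def powr_minus_divide)
  have Lsums: "(\<lambda>n. ch (Suc n) / of_nat (Suc n) powr s) sums L s" if "Re s > 1" for s
    unfolding conv using sums[OF that, of 0] L_eq[of 0 s] that by simp
  have "dirichlet_L ch = L"
    unfolding dirichlet_L_def
  proof (rule the_equality)
    fix F assume F: "F holomorphic_on UNIV \<and> (\<forall>s. Re s > 1 \<longrightarrow> (\<lambda>n. ch (Suc n) / of_nat (Suc n) powr s) sums F s)"
    show "F = L"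
    proof
      fix s
      show "F s = L s"
      \<comment> \<open>The abscissa is chosen so that the half-plane contains \<open>s\<close> as
        well as all points with real part above 1.\<close>
      proof (rule halfspace_continuation_unique[of F "min 1 (Re s - 1)" L])
        show "F w = L w" if "Re w > 1" for w
          using F Lsums[OF that] that sums_unique2 by blast
      qed (use F Lhol in \<open>auto intro: holomorphic_on_subset\<close>)
    qed
  qed (use Lhol Lsums in blast)
  moreover have "deriv L (-1) = deriv (E 3) (-1)"
    by (intro deriv_cong_ev nbhd) auto
  moreover have "npow (-1) = (\<lambda>w. w)" by (auto simp: npow_def)
  ultimately show ?thesis using lim[of 3 "-1"] unfolding g_def by auto
qed

subsection \<open>The log-sine integral as a limit of sums\<close>

text \<open>These are minus the \<open>x\<close>-derivatives of the summands of \<open>xlogx_diff\<close> below, the term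
  \<open>N ln N\<close> being distributed by telescoping so that the series converges.\<close>
definition gamma_diff :: "nat \<Rightarrow> real \<Rightarrow> real" where
  "gamma_diff m y = ln (real m + y) + ln (real m + 1 - y)
     + 2 - 2 * ((real m + 1) * ln (real m + 1) - real m * ln (real m))"

lemma sum_gamma_diff:
  "(\<Sum>m<N. gamma_diff m y) =
    (\<Sum>m<N. ln (real m + y) + ln (real m + 1 - y)) + 2 * real N - 2 * real N * ln (real N)"
  by (induction N) (simp_all add: gamma_diff_def algebra_simps)

text \<open>The two logarithms combine to that of \<open>m * (m + 1) + y * (1 - y)\<close>, which
  increases with \<open>y * (1 - y)\<close>. The extreme values occur at 0 and 1/2.\<close>

lemma gamma_diff_bound:
  assumes "m > 0" "0 \<le> y" "y \<le> 1"
  shows "\<bar>gamma_diff m y\<bar> \<le> \<bar>gamma_diff m 0\<bar> + \<bar>gamma_diff m (1/2)\<bar>"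
proof -
  have eq: "ln (real m + z) + ln (real m + 1 - z) = ln (real m * (real m + 1) + z * (1 - z))"
    if "0 \<le> z" "z \<le> 1" for z
    using assms(1) that by (subst ln_mult_pos[symmetric]) (auto simp: algebra_simps)
  have p: "0 < real m * (real m + 1)" using assms(1) by simp
  have "0 \<le> y * (1 - y)" using assms by simp
  moreover have "y * (1 - y) \<le> 1 / 2 * (1 - 1 / 2)"
    using zero_le_power2[of "y - 1 / 2"] by (simp add: power2_eq_square algebra_simps)
  ultimately have "gamma_diff m 0 \<le> gamma_diff m y" "gamma_diff m y \<le> gamma_diff m (1/2)"
    using eq[of y] eq[of 0] eq[of "1/2"] assms p unfolding gamma_diff_def
    by (auto intro!: ln_mono add_pos_nonneg simp: algebra_simps)
  then show ?thesis by linarith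
qed

text \<open>The bound by the values at 0 and 1/2 holds from \<open>m = 1\<close> on, which is enough
  for the M-test, and both values are of order \<open>1 / m ^ 2\<close>.\<close>

lemma gamma_diff_uniform_limit:
  assumes "S \<subseteq> {0..1}"
  shows "uniform_limit S (\<lambda>N y. \<Sum>m<N. gamma_diff m y) (\<lambda>y. \<Sum>m. gamma_diff m y) sequentially"
proof (rule Weierstrass_m_test_ev)
  show "\<forall>\<^sub>F m in sequentially. \<forall>y\<in>S. norm (gamma_diff m y) \<le> \<bar>gamma_diff m 0\<bar> + \<bar>gamma_diff m (1/2)\<bar>"
    using eventually_gt_at_top[of 0] by eventually_elim (use assms in \<open>auto intro!: gamma_diff_bound\<close>)
  have s2: "summable (\<lambda>m. norm (1 / real m ^ 2))"
    using inverse_power_summable[of 2, where 'a = real] by (simp add: field_simps)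
  have "(\<lambda>m. gamma_diff m 0) \<in> O(\<lambda>m. 1 / real m ^ 2)"
    unfolding gamma_diff_def by real_asymp
  moreover have "(\<lambda>m. gamma_diff m (1/2)) \<in> O(\<lambda>m. 1 / real m ^ 2)"
    unfolding gamma_diff_def by real_asymp
  ultimately show "summable (\<lambda>m. \<bar>gamma_diff m 0\<bar> + \<bar>gamma_diff m (1/2)\<bar>)"
    by (intro summable_add summable_comparison_test_bigo[OF s2]) auto
qed

lemma gamma_diff_LIMSEQ:
  assumes "0 \<le> y" "y \<le> 1"
  shows "(\<lambda>N. \<Sum>m<N. gamma_diff m y) \<longlonglongrightarrow> (\<Sum>m. gamma_diff m y)"
  using tendsto_uniform_limitI[OF gamma_diff_uniform_limit[of "{y}"]] assms by simp

text \<open>Regrouping pairs \<open>k + y\<close> with \<open>k - y\<close>, which leaves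
  \<open>y\<close> and \<open>N + 1 - y\<close> over. This produces the partial products of Euler's
  formula for the sine.\<close>

lemma prod_shifted_factors:
  fixes y :: real
  assumes "0 < y" "y < 1"
  shows "(\<Prod>m<Suc N. (real m + y) * (real m + 1 - y)) =
    y * (real N + 1 - y) * (fact N)\<^sup>2 * (\<Prod>k=1..N. 1 - y\<^sup>2 / (real k)\<^sup>2)"
proof (induction N)
  case (Suc N)
  have "(real N + 1)\<^sup>2 * (1 - y\<^sup>2 / (real N + 1)\<^sup>2) = (real N + 1)\<^sup>2 - y\<^sup>2"
    by (simp add: field_simps)
  also have "\<dots> = (real N + 1 - y) * (real N + 1 + y)"
    by (simp add: power2_eq_square algebra_simps)
  finally have e: "(real N + 1)\<^sup>2 * (1 - y\<^sup>2 / (real N + 1)\<^sup>2) = (real N + 1 - y) * (real N + 1 + y)" .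
  have "(\<Prod>m<Suc (Suc N). (real m + y) * (real m + 1 - y)) =
     y * (real N + 1 - y) * (fact N)\<^sup>2 * (\<Prod>k=1..N. 1 - y\<^sup>2 / (real k)\<^sup>2) * ((real N + 1 + y) * (real N + 2 - y))"
    unfolding prod.lessThan_Suc[of _ "Suc N"] Suc.IH by (simp add: add_ac)
  also have "\<dots> = y * (real N + 2 - y) * (fact N)\<^sup>2 * (\<Prod>k=1..N. 1 - y\<^sup>2 / (real k)\<^sup>2) *
      ((real N + 1 - y) * (real N + 1 + y))"
    by (simp add: mult_ac)
  also have "\<dots> = y * (real N + 2 - y) * (fact N)\<^sup>2 * (\<Prod>k=1..N. 1 - y\<^sup>2 / (real k)\<^sup>2) *
      ((real N + 1)\<^sup>2 * (1 - y\<^sup>2 / (real N + 1)\<^sup>2))"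
    unfolding e ..
  also have "\<dots> = y * (real (Suc N) + 1 - y) * (fact (Suc N))\<^sup>2 * (\<Prod>k=1..Suc N. 1 - y\<^sup>2 / (real k)\<^sup>2)"
    by (simp add: power_mult_distrib mult_ac add_ac)
  finally show ?case .
qed simp

text \<open>Comparing \<open>y\<close> with 1/2 cancels the factorials and the normalising terms.
  The quotient of the remaining partial products tends to \<open>sin (pi * y) / sin (pi / 2)\<close>
  by Euler's product.\<close>

lemma suminf_gamma_diff_half_plus:
  assumes "0 < y" "y < 1"
  shows "(\<Sum>m. gamma_diff m y) = (\<Sum>m. gamma_diff m (1/2)) + ln (sin (pi * y))"
proof -
  define P where "P N z = (\<Prod>m<N. (real m + z) * (real m + 1 - z))" for N and z :: real
  define R where "R N z = pi * z * (\<Prod>k=1..N. 1 - z\<^sup>2 / (real k)\<^sup>2)" for N and z :: real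
  have Ppos: "P N z > 0" if "0 < z" "z < 1" for N z
    unfolding P_def using that by (intro prod_pos) auto
  have lnP: "(\<Sum>m<N. gamma_diff m z) = ln (P N z) + 2 * real N - 2 * real N * ln (real N)"
    if z: "0 < z" "z < 1" for N z
  proof -
    have "ln (P N z) = (\<Sum>m<N. ln ((real m + z) * (real m + 1 - z)))"
      unfolding P_def using z by (intro ln_prod) auto
    also have "\<dots> = (\<Sum>m<N. ln (real m + z) + ln (real m + 1 - z))"
      using z by (intro sum.cong refl ln_mult_pos) auto
    finally show ?thesis unfolding sum_gamma_diff by simp
  qed
  have PR: "P (Suc N) z = R N z * ((real N + 1 - z) * (fact N)\<^sup>2 / pi)" if "0 < z" "z < 1" for N z
    unfolding P_def R_def prod_shifted_factors[OF that] by simp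
  have Rlim: "(\<lambda>N. R N z) \<longlonglongrightarrow> sin (pi * z)" for z
    unfolding R_def using sin_product_formula_real[of z] by simp
  have sy: "sin (pi * y) > 0" using assms by (intro sin_gt_zero) auto
  have "(\<lambda>N. R N y / R N (1/2) * ((real N + 1 - y) / (real N + 1 - 1/2))) \<longlonglongrightarrow> sin (pi * y) / sin (pi * (1/2)) * 1"
    by (intro tendsto_mult tendsto_divide Rlim) (simp, real_asymp)
  then have "(\<lambda>N. P (Suc N) y / P (Suc N) (1/2)) \<longlonglongrightarrow> sin (pi * y)"
    using assms by (simp add: PR mult_ac)
  then have "(\<lambda>N. ln (P (Suc N) y / P (Suc N) (1/2))) \<longlonglongrightarrow> ln (sin (pi * y))"
    using sy by (intro tendsto_ln) auto
  moreover have "ln (P (Suc N) y / P (Suc N) (1/2)) =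
      (\<Sum>m<Suc N. gamma_diff m y) - (\<Sum>m<Suc N. gamma_diff m (1/2))" for N
    using Ppos[of y "Suc N"] Ppos[of "1/2" "Suc N"] assms unfolding lnP[OF assms] lnP[of "1/2", simplified]
    by (simp add: ln_div)
  moreover have "(\<lambda>N. (\<Sum>m<Suc N. gamma_diff m y) - (\<Sum>m<Suc N. gamma_diff m (1/2))) \<longlonglongrightarrow>
     (\<Sum>m. gamma_diff m y) - (\<Sum>m. gamma_diff m (1/2))"
    using assms by (intro tendsto_diff LIMSEQ_Suc gamma_diff_LIMSEQ) auto
  ultimately have "ln (sin (pi * y)) = (\<Sum>m. gamma_diff m y) - (\<Sum>m. gamma_diff m (1/2))"
    using LIMSEQ_unique by auto
  then show ?thesis by simp
qed

text \<open>The duplication identity at \<open>1/4\<close> fixes the constant that Stirling's formula would give.\<close>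
lemma suminf_gamma_diff_half: "(\<Sum>m. gamma_diff m (1/2)) = ln 2"
proof -
  have dup: "(\<Sum>m<2 * N. ln (real m + 1/2) + ln (real m + 1 - 1/2)) =
     2 * (\<Sum>m<N. ln (real m + 1/4) + ln (real m + 1 - 1/4)) + 4 * real N * ln 2" for N
  proof (induction N)
    case (Suc N)
    have "ln (real (2 * N) + 1/2) = ln 2 + ln (real N + 1/4)"
      by (subst ln_mult_pos[symmetric]) (auto simp: algebra_simps)
    moreover have "ln (real (2 * N) + 3/2) = ln 2 + ln (real N + 3/4)"
      by (subst ln_mult_pos[symmetric]) (auto simp: algebra_simps)
    moreover have "real (2 * N) + 1 - 1/2 = real (2 * N) + 1/2" "real (Suc (2 * N)) + 1/2 = real (2 * N) + 3/2"
      "real (Suc (2 * N)) + 1 - 1/2 = real (2 * N) + 3/2" "real N + 1 - 1/4 = real N + 3/4" by simp_all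
    ultimately show ?case using Suc.IH unfolding mult_Suc_right add_2_eq_Suc sum.lessThan_Suc
      by (simp add: algebra_simps)
  qed simp
  have dup': "(\<Sum>m<2 * N. gamma_diff m (1/2)) = 2 * (\<Sum>m<N. gamma_diff m (1/4))" for N
  proof (cases "N = 0")
    case False
    then have "ln (real (2 * N)) = ln 2 + ln (real N)" by (simp add: ln_mult_pos)
    then show ?thesis unfolding sum_gamma_diff dup by (simp add: algebra_simps)
  qed simp
  have l1: "(\<lambda>N. \<Sum>m<2 * N. gamma_diff m (1/2)) \<longlonglongrightarrow> (\<Sum>m. gamma_diff m (1/2))"
    by (rule filterlim_compose[OF gamma_diff_LIMSEQ]) (auto intro: filterlim_subseq simp: strict_mono_def)
  have l2: "(\<lambda>N. 2 * (\<Sum>m<N. gamma_diff m (1/4))) \<longlonglongrightarrow> 2 * (\<Sum>m. gamma_diff m (1/4))"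
    by (intro tendsto_mult_left gamma_diff_LIMSEQ) auto
  have "(\<Sum>m. gamma_diff m (1/2)) = 2 * (\<Sum>m. gamma_diff m (1/4))"
    using LIMSEQ_unique[OF l1[unfolded dup'] l2] .
  moreover have "(\<Sum>m. gamma_diff m (1/4)) = (\<Sum>m. gamma_diff m (1/2)) + ln (sin (pi / 4))"
    using suminf_gamma_diff_half_plus[of "1/4"] by simp
  moreover have "ln (sin (pi / 4)) = - (ln 2 / 2)"
    by (simp add: sin_45 ln_div ln_sqrt)
  ultimately show ?thesis by simp
qed

lemma suminf_gamma_diff:
  assumes "0 < y" "y < 1"
  shows "(\<Sum>m. gamma_diff m y) = ln (2 * sin (pi * y))"
proof -
  have "sin (pi * y) > 0" using assms by (intro sin_gt_zero) auto
  then show ?thesis using suminf_gamma_diff_half_plus[OF assms] suminf_gamma_diff_half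
    by (simp add: ln_mult_pos)
qed

text \<open>This is \<Psi> of the overview. For \<open>x\<close> in [0, 1/2] it is the Clausen
  function at \<open>2 * pi * x\<close> divided by \<open>2 * pi\<close>.\<close>

definition log_sine :: "real \<Rightarrow> real" where
  "log_sine x = integral {x..1/2} (\<lambda>y. ln (2 * sin (pi * y)))"

text \<open>The antiderivative, vanishing at 1/2, of minus the partial sums of
  \<open>gamma_diff\<close>. The last term removes the growth in \<open>N\<close>.\<close>

definition xlogx_diff :: "nat \<Rightarrow> real \<Rightarrow> real" where
  "xlogx_diff N x = (\<Sum>m<N. (real m + 1 - x) * ln (real m + 1 - x) - (real m + x) * ln (real m + x))
     - (1 - 2 * x) * real N * ln (real N)"

text \<open>Integrate the partial sums of \<open>gamma_diff\<close> from \<open>x\<close> to 1/2 by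
  the fundamental theorem, then pass to the limit under the integral by uniform convergence.\<close>

lemma xlogx_diff_LIMSEQ:
  assumes x: "0 < x" "x \<le> 1/2"
  shows "(\<lambda>N. xlogx_diff N x) \<longlonglongrightarrow> log_sine x"
proof -
  have int: "((\<lambda>y. \<Sum>m<N. gamma_diff m y) has_integral xlogx_diff N x) {x..1/2}" for N
  proof -
    have "(xlogx_diff N has_real_derivative - (\<Sum>m<N. gamma_diff m y)) (at y)" if "0 < y" "y \<le> 1/2" for y
    proof -
      have "((\<lambda>y. (real m + 1 - y) * ln (real m + 1 - y) - (real m + y) * ln (real m + y)) has_real_derivative
          - (ln (real m + y) + ln (real m + 1 - y) + 2)) (at y)" for m
      proof -
        have p: "real m + 1 - y > 0" "real m + y > 0" using that by auto
        have "((\<lambda>y. (real m + 1 - y) * ln (real m + 1 - y)) has_real_derivative - ln (real m + 1 - y) - 1) (at y)"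
          by (rule derivative_eq_intros refl | use p in simp)+
        moreover have "((\<lambda>y. (real m + y) * ln (real m + y)) has_real_derivative ln (real m + y) + 1) (at y)"
          by (rule derivative_eq_intros refl | use p in simp)+
        ultimately have "((\<lambda>y. (real m + 1 - y) * ln (real m + 1 - y) - (real m + y) * ln (real m + y)) has_real_derivative
          (- ln (real m + 1 - y) - 1) - (ln (real m + y) + 1)) (at y)"
          by (rule DERIV_diff)
        then show ?thesis by (rule DERIV_cong) simp
      qed
      then have "((\<lambda>y. \<Sum>m<N. (real m + 1 - y) * ln (real m + 1 - y) - (real m + y) * ln (real m + y)) has_real_derivative
          (\<Sum>m<N. - (ln (real m + y) + ln (real m + 1 - y) + 2))) (at y)"
        by (rule DERIV_sum)
      moreover have "((\<lambda>y. (1 - 2 * y) * real N * ln (real N)) has_real_derivative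
          (0 - 2) * real N * ln (real N)) (at y)"
        by (auto intro!: derivative_eq_intros)
      ultimately have "(xlogx_diff N has_real_derivative
          (\<Sum>m<N. - (ln (real m + y) + ln (real m + 1 - y) + 2)) - (0 - 2) * real N * ln (real N)) (at y)"
        unfolding xlogx_diff_def[abs_def] by (rule DERIV_diff)
      then show ?thesis
        by (rule DERIV_cong) (unfold sum_gamma_diff sum_negf sum.distrib, simp)
    qed
    then have I: "((\<lambda>y. - (\<Sum>m<N. gamma_diff m y)) has_integral (xlogx_diff N (1/2) - xlogx_diff N x)) {x..1/2}"
      using x by (intro fundamental_theorem_of_calculus)
        (auto simp: has_real_derivative_iff_has_vector_derivative[symmetric] intro: has_field_derivative_at_within)
    have "xlogx_diff N (1/2) = 0" by (simp add: xlogx_diff_def add.commute)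
    then show ?thesis using has_integral_neg[OF I] by simp
  qed
  have cont: "continuous_on {x..1/2} (\<lambda>y. \<Sum>m<N. gamma_diff m y)" for N
    unfolding gamma_diff_def using x by (auto intro!: continuous_intros)
  have unif: "uniform_limit {x..1/2} (\<lambda>N y. \<Sum>m<N. gamma_diff m y) (\<lambda>y. \<Sum>m. gamma_diff m y) sequentially"
    using x by (intro gamma_diff_uniform_limit) auto
  obtain I J where I: "\<And>N. ((\<lambda>y. \<Sum>m<N. gamma_diff m y) has_integral I N) {x..1/2}"
    and J: "((\<lambda>y. \<Sum>m. gamma_diff m y) has_integral J) {x..1/2}" and "I \<longlonglongrightarrow> J"
    using uniform_limit_integral[OF unif cont] by auto
  have "I = (\<lambda>N. xlogx_diff N x)" using I int has_integral_unique by blast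
  moreover have "((\<lambda>y. ln (2 * sin (pi * y))) has_integral J) {x..1/2}"
    using x suminf_gamma_diff by (intro has_integral_eq[OF _ J]) auto
  then have "log_sine x = J" unfolding log_sine_def by (rule integral_unique)
  ultimately show ?thesis using \<open>I \<longlonglongrightarrow> J\<close> by simp
qed

section \<open>The derivative at -1 for odd periodic coefficients\<close>

lemma sum_odd_pairing:
  fixes ch F :: "nat \<Rightarrow> complex"
  assumes odd: "\<And>u. 0 < u \<Longrightarrow> u < f \<Longrightarrow> ch (f - u) = - ch u" and "ch f = 0"
  shows "(\<Sum>u<f. ch (Suc u) * F (Suc u)) = (\<Sum>u | 0 < u \<and> 2 * u < f. ch u * (F u - F (f - u)))"
proof -
  let ?A = "{u. 0 < u \<and> 2 * u < f}" and ?B = "{u. 0 < u \<and> u < f \<and> f < 2 * u}" and ?C = "{u. 0 < u \<and> u < f \<and> 2 * u = f}"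
  have fin: "finite ?A" "finite ?B" "finite ?C"
    by (rule finite_subset[of _ "{..<f}"]; auto)+
  have "(\<Sum>u<f. ch (Suc u) * F (Suc u)) = (\<Sum>u\<in>{1..f}. ch u * F u)"
    by (rule sum.reindex_bij_witness[of _ "\<lambda>u. u - 1" Suc]) auto
  also have "\<dots> = (\<Sum>u\<in>?A \<union> ?B \<union> ?C. ch u * F u)"
    by (rule sum.mono_neutral_right) (use \<open>ch f = 0\<close> in \<open>auto simp: not_less le_less\<close>)
  also have "\<dots> = (\<Sum>u\<in>?A. ch u * F u) + (\<Sum>u\<in>?B. ch u * F u) + (\<Sum>u\<in>?C. ch u * F u)"
    using fin by (subst sum.union_disjoint, simp, simp, force)+ simp
  \<comment> \<open>At the midpoint, which exists only for even \<open>f\<close>, oddness reads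
    \<open>ch u = - ch u\<close>.\<close>
  also have "(\<Sum>u\<in>?C. ch u * F u) = 0"
  proof (rule sum.neutral, rule ballI)
    fix u assume "u \<in> ?C"
    then have u: "0 < u" "u < f" "f = 2 * u" by auto
    then have "ch u = - ch u" using odd[of u] by simp
    then show "ch u * F u = 0" by simp
  qed
  also have "(\<Sum>u\<in>?B. ch u * F u) = (\<Sum>u\<in>?A. - ch u * F (f - u))"
    by (rule sum.reindex_bij_witness[of _ "\<lambda>u. f - u" "\<lambda>u. f - u"]) (auto simp: odd)
  finally show ?thesis by (simp add: sum.distrib[symmetric] algebra_simps)
qed

text \<open>Both functions tend to infinity, at different rates. Dividing by the faster one gives
  \<open>a = 0\<close>, then dividing by the slower one gives \<open>b = 0\<close>. Hence the
  boundary coefficients never have to be computed.\<close>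

lemma linear_log_growth_limit:
  fixes a b l :: complex and f :: nat
  assumes f: "f > 0"
    and lim: "(\<lambda>M. a * of_real (real M * real f * ln (real M * real f)) + b * of_real (ln (real M * real f) + 1)) \<longlonglongrightarrow> l"
  shows "l = 0"
proof -
  have fr: "real f > 0" using f by simp
  have 1: "(\<lambda>M. of_real (1 / (real M * real f * ln (real M * real f))) :: complex) \<longlonglongrightarrow> of_real 0"
    using fr by (intro tendsto_of_real) real_asymp
  have 2: "(\<lambda>M. of_real ((ln (real M * real f) + 1) / (real M * real f * ln (real M * real f))) :: complex) \<longlonglongrightarrow> of_real 0"
    using fr by (intro tendsto_of_real) real_asymp
  have pos: "\<forall>\<^sub>F M in sequentially. real M * real f * ln (real M * real f) > 0"
    using fr by real_asymp
  have "(\<lambda>M. (a * of_real (real M * real f * ln (real M * real f)) + b * of_real (ln (real M * real f) + 1))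
      * of_real (1 / (real M * real f * ln (real M * real f)))
      - b * of_real ((ln (real M * real f) + 1) / (real M * real f * ln (real M * real f)))) \<longlonglongrightarrow> l * of_real 0 - b * of_real 0"
    by (intro tendsto_diff tendsto_mult lim 1 2 tendsto_const)
  moreover have "\<forall>\<^sub>F M in sequentially. (a * of_real (real M * real f * ln (real M * real f)) + b * of_real (ln (real M * real f) + 1))
      * of_real (1 / (real M * real f * ln (real M * real f)))
      - b * of_real ((ln (real M * real f) + 1) / (real M * real f * ln (real M * real f))) = a"
    using pos
  proof eventually_elim
    case (elim M)
    define t where "t = real M * real f * ln (real M * real f)"
    define s where "s = ln (real M * real f) + 1"
    have "t > 0" using elim by (simp add: t_def)
    then show ?case unfolding t_def[symmetric] s_def[symmetric]
      by (simp add: field_simps)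
  qed
  ultimately have "(\<lambda>_::nat. a) \<longlonglongrightarrow> 0" using tendsto_cong by fastforce
  then have a: "a = 0" by (simp add: tendsto_const_iff)
  have 3: "(\<lambda>M. of_real (1 / (ln (real M * real f) + 1)) :: complex) \<longlonglongrightarrow> of_real 0"
    using fr by (intro tendsto_of_real) real_asymp
  have "(\<lambda>M. b * of_real (ln (real M * real f) + 1) * of_real (1 / (ln (real M * real f) + 1))) \<longlonglongrightarrow> l * of_real 0"
    using lim unfolding a by (intro tendsto_mult 3) simp
  moreover have "\<forall>\<^sub>F M in sequentially. ln (real M * real f) + 1 > 0"
    using fr by real_asymp
  then have "\<forall>\<^sub>F M in sequentially. b * of_real (ln (real M * real f) + 1) * of_real (1 / (ln (real M * real f) + 1)) = b"
  proof eventually_elim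
    case (elim M)
    define s where "s = ln (real M * real f) + 1"
    show ?case using elim unfolding s_def[symmetric] by simp
  qed
  ultimately have "(\<lambda>_::nat. b) \<longlonglongrightarrow> 0" using tendsto_cong by fastforce
  then have "b = 0" by (simp add: tendsto_const_iff)
  then show ?thesis using lim a LIMSEQ_unique by auto
qed

text \<open>Write \<open>m * f + u = f * (m + u / f)\<close>. The \<open>ln f\<close> split off from
  each term joins the \<open>ln M\<close> of the correction in \<open>xlogx_diff\<close> to form
  \<open>ln (M * f)\<close>.\<close>

lemma sum_xlogx_blocks:
  fixes f u M :: nat
  assumes u: "0 < u" "2 * u < f" and M: "M > 0"
  shows "(\<Sum>m<M. - (ln (real (m * f + u)) * real (m * f + u)) + ln (real (m * f + (f - u))) * real (m * f + (f - u)))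
    = real f * xlogx_diff M (real u / real f) + (real f - 2 * real u) * real M * ln (real M * real f)"
proof -
  define x where "x = real u / real f"
  have f: "real f > 0" using u by simp
  have x: "0 < x" "x < 1" "real f * x = real u" using u f by (auto simp: x_def field_simps)
  have "- (ln (real (m * f + u)) * real (m * f + u)) + ln (real (m * f + (f - u))) * real (m * f + (f - u)) =
     real f * ((real m + 1 - x) * ln (real m + 1 - x) - (real m + x) * ln (real m + x)) + real f * ln (real f) * (1 - 2 * x)" for m
  proof -
    have 1: "real (m * f + u) = real f * (real m + x)" using x by (simp add: algebra_simps)
    have 2: "real (m * f + (f - u)) = real f * (real m + 1 - x)" using x u by (simp add: algebra_simps of_nat_diff)
    have "ln (real f * (real m + x)) = ln (real f) + ln (real m + x)"
      "ln (real f * (real m + 1 - x)) = ln (real f) + ln (real m + 1 - x)"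
      using f x by (auto intro!: ln_mult_pos)
    then show ?thesis unfolding 1 2 by (simp add: algebra_simps)
  qed
  then have "(\<Sum>m<M. - (ln (real (m * f + u)) * real (m * f + u)) + ln (real (m * f + (f - u))) * real (m * f + (f - u)))
    = real f * (\<Sum>m<M. (real m + 1 - x) * ln (real m + 1 - x) - (real m + x) * ln (real m + x)) + real M * (real f * ln (real f) * (1 - 2 * x))"
    by (simp add: sum.distrib sum_distrib_left)
  also have "\<dots> = real f * xlogx_diff M x + (real f - 2 * (real f * x)) * real M * (ln (real M) + ln (real f))"
    by (simp add: xlogx_diff_def algebra_simps)
  also have "ln (real M) + ln (real f) = ln (real M * real f)"
    using M f by (simp add: ln_mult_pos)
  finally show ?thesis unfolding x(3) unfolding x_def .
qed

text \<open>With \<open>N = M * f\<close>, the corrected partial sums equal \<open>S M\<close> plus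
  a combination of \<open>N ln N\<close> and \<open>ln N + 1\<close>, up to a null sequence. They
  converge and so does \<open>S M\<close>, so the combination converges and its limit must be
  0.\<close>

lemma deriv_dirichlet_L_odd_periodic:
  fixes ch :: "nat \<Rightarrow> complex"
  assumes f: "f > 0" and per: "\<And>n. n > 0 \<Longrightarrow> ch (n + f) = ch n"
    and odd: "\<And>u. 0 < u \<Longrightarrow> u < f \<Longrightarrow> ch (f - u) = - ch u" and ch_f: "ch f = 0"
  shows "deriv (dirichlet_L ch) (-1) =
    of_nat f * (\<Sum>u | 0 < u \<and> 2 * u < f. ch u * of_real (log_sine (real u / real f)))"
proof -
  define A where "A = {u. 0 < u \<and> 2 * u < f}"
  have fr: "real f > 0" using f by simp
  have "(\<Sum>u<f. ch (Suc u)) = 0"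
    using sum_odd_pairing[of f ch "\<lambda>_. 1", OF odd ch_f] by simp
  moreover have "ch (Suc (n + f)) = ch (Suc n)" for n using per[of "Suc n"] by simp
  ultimately have "mean_zero_periodic f (\<lambda>n. ch (Suc n))"
    using f by (simp add: mean_zero_periodic_def)
  from dirichlet_L_mean_zero_periodic[OF this] obtain c where
    lim: "(\<lambda>M. (\<Sum>n<M * f. ch (Suc n) * (- Ln (of_nat (Suc n)) * of_nat (Suc n)))
       - (\<Sum>j<3. c j * fdiff j (\<lambda>w. - Ln w * w) (of_nat (M * f) + 1))) \<longlonglongrightarrow> deriv (dirichlet_L ch) (-1)"
    by blast
  define W where "W = (\<Sum>u\<in>A. ch u * of_real (real f - 2 * real u))"
  define S where "S M = of_nat f * (\<Sum>u\<in>A. ch u * of_real (xlogx_diff M (real u / real f)))" for M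
  define N where "N M = real M * real f" for M
  define e where "e r = - (ln r * r)" for r :: real
  have block: "(\<Sum>n<M * f. ch (Suc n) * (- Ln (of_nat (Suc n)) * of_nat (Suc n))) =
     S M + W * of_real (real M * ln (N M))" if M: "M > 0" for M
  proof -
    define F where "F v = - complex_of_real (ln (real v) * real v)" for v :: nat
    have per': "ch (m * f + Suc u) = ch (Suc u)" for m u
      by (induction m) (use per in \<open>simp_all add: add_ac\<close>, metis add.assoc add.commute add_Suc_right per zero_less_Suc)
    have "(\<Sum>n<M * f. ch (Suc n) * (- Ln (of_nat (Suc n)) * of_nat (Suc n))) = (\<Sum>n<M * f. ch (Suc n) * F (Suc n))"
      unfolding F_def by (intro sum.cong refl) (simp del: of_nat_Suc)
    also have "\<dots> = (\<Sum>m<M. \<Sum>u<f. ch (m * f + Suc u) * F (m * f + Suc u))"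
      unfolding sum_blocks by simp
    also have "\<dots> = (\<Sum>m<M. \<Sum>u\<in>A. ch u * (F (m * f + u) - F (m * f + (f - u))))"
      unfolding per' A_def by (intro sum.cong refl sum_odd_pairing[of f ch, OF odd ch_f])
    also have "\<dots> = (\<Sum>u\<in>A. ch u * (\<Sum>m<M. F (m * f + u) - F (m * f + (f - u))))"
      by (subst sum.swap) (simp add: sum_distrib_left)
    also have "\<dots> = (\<Sum>u\<in>A. ch u * of_real (real f * xlogx_diff M (real u / real f) + (real f - 2 * real u) * real M * ln (N M)))"
    proof (intro sum.cong refl arg_cong[of _ _ "(*) _"])
      fix u assume u: "u \<in> A"
      have "(\<Sum>m<M. F (m * f + u) - F (m * f + (f - u))) =
        of_real (\<Sum>m<M. - (ln (real (m * f + u)) * real (m * f + u)) + ln (real (m * f + (f - u))) * real (m * f + (f - u)))"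
        unfolding F_def of_real_sum by (intro sum.cong refl) (simp del: of_nat_add of_nat_mult)
      also have "\<dots> = of_real (real f * xlogx_diff M (real u / real f) + (real f - 2 * real u) * real M * ln (N M))"
        using u M unfolding N_def by (subst sum_xlogx_blocks) (auto simp: A_def)
      finally show "(\<Sum>m<M. F (m * f + u) - F (m * f + (f - u))) =
        of_real (real f * xlogx_diff M (real u / real f) + (real f - 2 * real u) * real M * ln (N M))" .
    qed
    also have "\<dots> = (\<Sum>u\<in>A. of_nat f * (ch u * of_real (xlogx_diff M (real u / real f)))
        + ch u * of_real (real f - 2 * real u) * of_real (real M * ln (N M)))"
      by (intro sum.cong refl) (simp add: algebra_simps)
    also have "\<dots> = S M + W * of_real (real M * ln (N M))"
      unfolding S_def W_def by (simp only: sum.distrib sum_distrib_left sum_distrib_right)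
    finally show ?thesis .
  qed
  have boundary: "(\<Sum>j<3. c j * fdiff j (\<lambda>w. - Ln w * w) (of_nat (M * f) + 1)) =
     c 0 * of_real (e (N M + 1)) + c 1 * of_real (e (N M + 1) - e (N M + 2))
      + c 2 * of_real (e (N M + 1) - 2 * e (N M + 2) + e (N M + 3))" for M
  proof -
    have l: "- Ln (of_real r) * of_real r = of_real (e r)" if "r > 0" for r :: real
      using that by (simp add: e_def Ln_of_real)
    have N0: "N M \<ge> 0" by (simp add: N_def)
    have z: "of_nat (M * f) + 1 = complex_of_real (N M + 1)"
      "complex_of_real (N M + 1) + 1 = complex_of_real (N M + 2)"
      "complex_of_real (N M + 2) + 1 = complex_of_real (N M + 3)" by (simp_all add: N_def)
    have g0: "fdiff 0 (\<lambda>w. - Ln w * w) (of_real (N M + 1)) = of_real (e (N M + 1))"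
      unfolding fdiff.simps by (rule l) (use N0 in simp)
    have g1: "fdiff 1 (\<lambda>w. - Ln w * w) (of_real (N M + 1)) = of_real (e (N M + 1)) - of_real (e (N M + 2))"
      unfolding One_nat_def fdiff.simps z by (intro arg_cong2[of _ _ _ _ "(-)"] l) (use N0 in simp_all)
    have g2: "fdiff 2 (\<lambda>w. - Ln w * w) (of_real (N M + 1)) =
       (of_real (e (N M + 1)) - of_real (e (N M + 2))) - (of_real (e (N M + 2)) - of_real (e (N M + 3)))"
      unfolding numeral_2_eq_2 fdiff.simps z
      by (intro arg_cong2[of _ _ _ _ "(-)"] l) (use N0 in simp_all)
    have three: "(\<Sum>j<3. X j) = X 0 + X 1 + X 2" for X :: "nat \<Rightarrow> complex"
      by (simp add: eval_nat_numeral)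
    show ?thesis unfolding three z g0 g1 g2 by (simp add: algebra_simps)
  qed
  \<comment> \<open>The errors in the asymptotics of the three boundary terms:
    \<open>e (N + 1)\<close> is \<open>-(N ln N + ln N + 1)\<close>, its first difference is
    \<open>ln N + 1\<close>, and its second difference is 0, each up to a null sequence.\<close>
  define d0 where "d0 M = e (N M + 1) + (N M * ln (N M) + ln (N M) + 1)" for M
  define d1 where "d1 M = e (N M + 1) - e (N M + 2) - (ln (N M) + 1)" for M
  define d2 where "d2 M = e (N M + 1) - 2 * e (N M + 2) + e (N M + 3)" for M
  have d0: "d0 \<longlonglongrightarrow> 0" unfolding d0_def[abs_def] e_def N_def using fr by real_asymp
  have d1: "d1 \<longlonglongrightarrow> 0" unfolding d1_def[abs_def] e_def N_def using fr by real_asymp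
  have d2: "d2 \<longlonglongrightarrow> 0" unfolding d2_def[abs_def] e_def N_def using fr by real_asymp
  define a where "a = W / of_nat f + c 0"
  define b where "b = c 0 - c 1"
  define Z where "Z = of_nat f * (\<Sum>u\<in>A. ch u * of_real (log_sine (real u / real f)))"
  have S: "S \<longlonglongrightarrow> Z"
    unfolding S_def[abs_def] Z_def
  proof (intro tendsto_mult tendsto_const tendsto_sum tendsto_of_real)
    fix u assume "u \<in> A"
    then show "(\<lambda>M. xlogx_diff M (real u / real f)) \<longlonglongrightarrow> log_sine (real u / real f)"
      using fr by (intro xlogx_diff_LIMSEQ) (auto simp: A_def field_simps)
  qed
  have "(\<lambda>M. ((\<Sum>n<M * f. ch (Suc n) * (- Ln (of_nat (Suc n)) * of_nat (Suc n)))
       - (\<Sum>j<3. c j * fdiff j (\<lambda>w. - Ln w * w) (of_nat (M * f) + 1)))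
       - S M + c 0 * of_real (d0 M) + c 1 * of_real (d1 M) + c 2 * of_real (d2 M))
     \<longlonglongrightarrow> deriv (dirichlet_L ch) (-1) - Z + c 0 * of_real 0 + c 1 * of_real 0 + c 2 * of_real 0"
    by (intro tendsto_add tendsto_diff tendsto_mult tendsto_const tendsto_of_real lim S d0 d1 d2)
  moreover have "\<forall>\<^sub>F M in sequentially. ((\<Sum>n<M * f. ch (Suc n) * (- Ln (of_nat (Suc n)) * of_nat (Suc n)))
       - (\<Sum>j<3. c j * fdiff j (\<lambda>w. - Ln w * w) (of_nat (M * f) + 1)))
       - S M + c 0 * of_real (d0 M) + c 1 * of_real (d1 M) + c 2 * of_real (d2 M)
     = a * of_real (N M * ln (N M)) + b * of_real (ln (N M) + 1)"
    using eventually_gt_at_top[of 0]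
  proof eventually_elim
    case (elim M)
    have "W * of_real (real M * ln (N M)) = W / of_nat f * of_real (N M * ln (N M))"
      using f by (simp add: N_def)
    then show ?case
      unfolding block[OF elim] boundary d0_def d1_def d2_def a_def b_def
      by (simp add: algebra_simps)
  qed
  ultimately have "(\<lambda>M. a * of_real (N M * ln (N M)) + b * of_real (ln (N M) + 1))
     \<longlonglongrightarrow> deriv (dirichlet_L ch) (-1) - Z"
    using tendsto_cong by fastforce
  then have "deriv (dirichlet_L ch) (-1) - Z = 0"
    unfolding N_def by (rule linear_log_growth_limit[OF f])
  then show ?thesis by (simp add: Z_def A_def)
qed

subsection \<open>Jensen's formula\<close>

text \<open>\<open>1 + b * z\<close> has positive real part on the closed unit disc, so
  \<open>Ln (1 + b * z)\<close> is holomorphic there and its mean over the circle is its value 0 at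
  the centre. The real part is the claim.\<close>

lemma has_integral_ln_norm_circle_small:
  fixes b :: complex
  assumes "norm b < 1"
  shows "((\<lambda>s. ln (norm (1 + b * cis s))) has_integral 0) {0..2 * pi}"
proof -
  have Re: "Re (1 + b * z) > 0" if "norm z \<le> 1" for z
  proof -
    have "norm (b * z) < 1"
      unfolding norm_mult using assms that mult_mono[of "norm b" "norm b" "norm z" 1] by auto
    then have "\<bar>Re (b * z)\<bar> < 1" using abs_Re_le_cmod le_less_trans by blast
    then show ?thesis by (simp only: plus_complex.sel one_complex.sel)
  qed
  have hol: "(\<lambda>z. Ln (1 + b * z)) holomorphic_on cball 0 1"
  proof (intro holomorphic_intros)
    fix z :: complex assume "z \<in> cball 0 1"
    then show "1 + b * z \<notin> \<real>\<^sub>\<le>\<^sub>0"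
      using Re[of z] by (auto simp: complex_nonpos_Reals_iff)
  qed
  have "((\<lambda>u. Ln (1 + b * u) / (u - 0)) has_contour_integral (2 * of_real pi * \<i> * Ln (1 + b * 0))) (circlepath 0 1)"
    by (rule Cauchy_integral_circlepath_simple[OF hol]) simp
  then have "((\<lambda>s. Ln (1 + b * (0 + of_real 1 * cis s)) / (0 + of_real 1 * cis s - 0) * of_real 1 * \<i> * cis s) has_integral
      2 * of_real pi * \<i> * Ln (1 + b * 0)) {0..2 * pi}"
    unfolding circlepath_def by (subst (asm) has_contour_integral_part_circlepath_iff) auto
  then have "((\<lambda>s. \<i> * Ln (1 + b * cis s)) has_integral 0) {0..2 * pi}"
    by (simp add: mult.commute)
  from has_integral_linear[OF this bounded_linear_Im]
  have "((\<lambda>s. Re (Ln (1 + b * cis s))) has_integral 0) {0..2 * pi}"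
    by (simp add: o_def)
  then show ?thesis
  proof (rule has_integral_eq[rotated])
    fix s show "Re (Ln (1 + b * cis s)) = ln (norm (1 + b * cis s))"
    proof (rule Re_Ln)
      show "1 + b * cis s \<noteq> 0"
        using Re[of "cis s"] by (metis less_irrefl norm_cis order_refl zero_complex.sel(1))
    qed
  qed
qed

text \<open>Factor out the larger of \<open>norm w\<close> and \<open>a\<close>, leaving
  \<open>1 + b * cis s\<close> with \<open>norm b < 1\<close>. If \<open>norm w\<close> is larger,
  conjugate and multiply by \<open>cis s\<close> first; neither changes the norm. The case of
  equality, where a zero lies on the circle, is excluded and later falls into a null set.\<close>

lemma has_integral_ln_norm_circle:
  fixes w :: complex and a :: real
  assumes "a > 0" "norm w \<noteq> a"
  shows "((\<lambda>s. ln (norm (w * cis s + of_real a))) has_integral 2 * pi * ln (max (norm w) a)) {0..2 * pi}"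
proof -
  have *: "((\<lambda>s. ln (norm (w * cis s + of_real a))) has_integral 2 * pi * ln r) {0..2 * pi}"
    if r: "r > 0" and b: "norm b < 1" and eq: "\<And>s. norm (w * cis s + of_real a) = r * norm (1 + b * cis s)" for r b
  proof -
    have "((\<lambda>s. ln r) has_integral 2 * pi * ln r) {0..2 * pi}"
      using has_integral_const_real[of "ln r" 0 "2 * pi"] by simp
    from has_integral_add[OF this has_integral_ln_norm_circle_small[OF b]]
    have "((\<lambda>s. ln r + ln (norm (1 + b * cis s))) has_integral 2 * pi * ln r) {0..2 * pi}"
      by simp
    then show ?thesis
    proof (rule has_integral_eq[rotated])
      fix s
      have "1 + b * cis s \<noteq> 0"
      proof
        assume "1 + b * cis s = 0"
        then have "norm (b * cis s) = norm (- 1 :: complex)" by (metis add_eq_0_iff)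
        then show False using b by (simp add: norm_mult)
      qed
      then show "ln r + ln (norm (1 + b * cis s)) = ln (norm (w * cis s + of_real a))"
        unfolding eq using r by (simp add: ln_mult_pos)
    qed
  qed
  show ?thesis
  proof (cases "norm w < a")
    case True
    have "norm (w * cis s + of_real a) = a * norm (1 + (w / of_real a) * cis s)" for s
    proof -
      have "w * cis s + of_real a = of_real a * (1 + (w / of_real a) * cis s)"
        using assms by (simp add: field_simps)
      then show ?thesis using assms by (simp add: norm_mult)
    qed
    then show ?thesis using *[of a "w / of_real a"] True assms by (simp add: norm_divide max_def)
  next
    case False
    then have w: "norm w > a" "w \<noteq> 0" using assms by auto
    have "norm (w * cis s + of_real a) = norm w * norm (1 + (of_real a / cnj w) * cis s)" for s
    proof -
      have cis: "cis s * cnj (cis s) = 1" by (simp add: cis_cnj cis_mult)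
      have "cnj (w * cis s + of_real a) * cis s = cnj w * (1 + (of_real a / cnj w) * cis s)"
        using w cis by (simp add: algebra_simps)
      then have "norm (cnj (w * cis s + of_real a) * cis s) = norm (cnj w * (1 + (of_real a / cnj w) * cis s))"
        by simp
      then show ?thesis by (simp only: norm_mult complex_mod_cnj norm_cis mult_1_right)
    qed
    then show ?thesis using *[of "norm w" "of_real a / cnj w"] w assms by (simp add: norm_divide max_def)
  qed
qed

section \<open>Countable exceptional sets, and the mean of
  \<open>ln (max (norm (1 + cis v)) a)\<close>\<close>

lemma countable_cos_eq: "countable {v. cos v = (c::real)}"
proof (cases "\<exists>v. cos v = c")
  case True
  then obtain v0 where v0: "cos v0 = c" by blast
  have "{v. cos v = c} \<subseteq> range (\<lambda>k::int. v0 + 2 * pi * of_int k) \<union> range (\<lambda>k::int. - v0 + 2 * pi * of_int k)"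
  proof
    fix v assume "v \<in> {v. cos v = c}"
    then have c: "cos v = cos v0" using v0 by simp
    then have "(sin v)\<^sup>2 = (sin v0)\<^sup>2" by (simp add: sin_squared_eq)
    then consider "sin v = sin v0" | "sin v = sin (- v0)" by (auto simp: power2_eq_iff)
    then show "v \<in> range (\<lambda>k::int. v0 + 2 * pi * of_int k) \<union> range (\<lambda>k::int. - v0 + 2 * pi * of_int k)"
      using c sin_cos_eq_iff[of v v0] sin_cos_eq_iff[of v "- v0"] by cases auto
  qed
  then show ?thesis by (rule countable_subset) auto
qed auto

lemma countable_cis_eq: "countable {t. cis t = c}"
proof (rule countable_subset[OF _ countable_cos_eq[of "Re c"]], rule subsetI)
  fix t assume "t \<in> {t. cis t = c}"
  then have "Re (cis t) = Re c" by simp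
  then show "t \<in> {v. cos v = Re c}" by simp
qed

lemma norm_one_plus_cis: "norm (1 + cis v) = 2 * \<bar>cos (v / 2)\<bar>"
proof -
  have "(norm (1 + cis v))\<^sup>2 = 2 + 2 * cos v"
    unfolding cmod_power2 using sin_cos_squared_add3[of v]
    by (simp add: power2_eq_square algebra_simps)
  also have "\<dots> = (2 * \<bar>cos (v / 2)\<bar>)\<^sup>2"
    using cos_double_cos[of "v / 2"] by (simp add: power_mult_distrib)
  finally show ?thesis by (rule power2_eq_imp_eq) auto
qed

lemma countable_norm_one_plus_cis_eq: "countable {v. norm (1 + cis v) = a}"
proof (rule countable_subset[OF _ countable_cos_eq[of "a\<^sup>2 / 2 - 1"]], safe)
  fix v assume "a = norm (1 + cis v)"
  then have "a\<^sup>2 = (2 * \<bar>cos (v / 2)\<bar>)\<^sup>2" by (simp add: norm_one_plus_cis)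
  then show "cos v = (norm (1 + cis v))\<^sup>2 / 2 - 1"
    using cos_double_cos[of "v / 2"] by (simp add: power_mult_distrib norm_one_plus_cis)
qed

text \<open>Putting \<open>v = pi - 2 * pi * y\<close> or \<open>v = pi + 2 * pi * y\<close> turns
  \<open>norm (1 + cis v)\<close> into \<open>2 * \<bar>sin (pi * y)\<bar>\<close>. On the two outer
  arcs, where \<open>y \<ge> x\<close>, the norm is the maximum and each arc gives
  \<open>2 * pi * log_sine x\<close>. On the middle arc, of length \<open>4 * pi * x\<close>, the
  maximum is \<open>a\<close>.\<close>

lemma has_integral_ln_max_norm:
  assumes x: "0 < x" "x < 1/2" and a: "a = 2 * sin (pi * x)"
  shows "((\<lambda>v. ln (max (norm (1 + cis v)) a)) has_integral 4 * pi * (log_sine x + x * ln a)) {0..2 * pi}"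
proof -
  have sin_pos: "sin (pi * y) > 0" if "x \<le> y" "y \<le> 1/2" for y
    using x that by (intro sin_gt_zero) auto
  have mono: "sin (pi * y) \<le> sin (pi * z)" if "0 \<le> y" "y \<le> z" "z \<le> 1/2" for y z
  proof (rule sin_monotone_2pi_le)
    show "- (pi / 2) \<le> pi * y" by (rule order_trans[of _ 0]) (use that in auto)
  qed (use that in auto)
  have "(\<lambda>y. ln (2 * sin (pi * y))) integrable_on {x..1/2}"
    using sin_pos by (intro integrable_continuous_real continuous_intros) force+
  then have L: "((\<lambda>y. ln (2 * sin (pi * y))) has_integral log_sine x) (cbox x (1/2))"
    unfolding log_sine_def cbox_interval by (rule integrable_integral)
  define p where "p = pi - 2 * pi * x"
  define q where "q = pi + 2 * pi * x"
  have pq: "0 \<le> p" "p \<le> q" "q \<le> 2 * pi" using x by (auto simp: p_def q_def field_simps)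
  have c1: "2 * \<bar>cos (v / 2)\<bar> = 2 * \<bar>sin (pi * y)\<bar>" if "v = pi - 2 * pi * y \<or> v = pi + 2 * pi * y" for v y
  proof -
    have "v / 2 = pi / 2 - pi * y \<or> v / 2 = pi / 2 + pi * y" using that by (auto simp: field_simps)
    then show ?thesis
    proof
      assume e: "v / 2 = pi / 2 - pi * y"
      show ?thesis unfolding e by (simp add: cos_diff)
    next
      assume e: "v / 2 = pi / 2 + pi * y"
      show ?thesis unfolding e by (simp add: cos_add)
    qed
  qed
  \<comment> \<open>\<open>img\<close> and \<open>val\<close> put into readable form the interval
    and the scaled value that the substitution \<open>y = v / (2 * pi) - 1/2\<close>
    produces.\<close>
  have img: "cbox ((u - (- 1/2)) /\<^sub>R (1 / (2 * pi))) ((w - (- 1/2)) /\<^sub>R (1 / (2 * pi))) = {pi + 2 * pi * u..pi + 2 * pi * w}" for u w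
  proof -
    have "t /\<^sub>R (1 / (2 * pi)) = 2 * pi * t" for t :: real by simp
    then show ?thesis by (simp add: algebra_simps)
  qed
  have val: "log_sine x /\<^sub>R (1 / (2 * pi)) ^ DIM(real) = 2 * pi * log_sine x"
    by simp
  have I1: "((\<lambda>v. ln (max (norm (1 + cis v)) a)) has_integral 2 * pi * log_sine x) {0..p}"
  proof -
    have "((\<lambda>y. ln (2 * sin (pi * (- y)))) has_integral log_sine x) (cbox (- (1/2)) (- x))"
      using L has_integral_reflect_real[of "\<lambda>y. ln (2 * sin (pi * y))"] by simp
    from has_integral_affinity'[OF this, of "1 / (2 * pi)" "- 1/2", unfolded img val]
    have "((\<lambda>v. ln (2 * sin (pi * (- ((1 / (2 * pi)) *\<^sub>R v + - 1/2))))) has_integral 2 * pi * log_sine x) {0..p}"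
      by (simp add: p_def)
    then show ?thesis
    proof (rule has_integral_eq[rotated])
      fix v assume "v \<in> {0..p}"
      define y where "y = - ((1 / (2 * pi)) *\<^sub>R v + - 1/2)"
      have y: "x \<le> y" "y \<le> 1/2" "v = pi - 2 * pi * y"
        using \<open>v \<in> {0..p}\<close> by (auto simp: y_def p_def field_simps)
      have "norm (1 + cis v) = 2 * sin (pi * y)"
        unfolding norm_one_plus_cis using c1[of v y] y sin_pos[of y] by simp
      then show "ln (2 * sin (pi * (- ((1 / (2 * pi)) *\<^sub>R v + - 1/2)))) = ln (max (norm (1 + cis v)) a)"
        using mono[of x y] y x a unfolding y_def[symmetric] by (simp add: max_def)
    qed
  qed
  have I2: "((\<lambda>v. ln (max (norm (1 + cis v)) a)) has_integral 2 * pi * log_sine x) {q..2 * pi}"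
  proof -
    from has_integral_affinity'[OF L, of "1 / (2 * pi)" "- 1/2", unfolded img val]
    have "((\<lambda>v. ln (2 * sin (pi * ((1 / (2 * pi)) *\<^sub>R v + - 1/2)))) has_integral 2 * pi * log_sine x) {q..2 * pi}"
      by (simp add: q_def)
    then show ?thesis
    proof (rule has_integral_eq[rotated])
      fix v assume "v \<in> {q..2 * pi}"
      define y where "y = (1 / (2 * pi)) *\<^sub>R v + - 1/2"
      have y: "x \<le> y" "y \<le> 1/2" "v = pi + 2 * pi * y"
        using \<open>v \<in> {q..2 * pi}\<close> by (auto simp: y_def q_def field_simps)
      have "norm (1 + cis v) = 2 * sin (pi * y)"
        unfolding norm_one_plus_cis using c1[of v y] y sin_pos[of y] by simp
      then show "ln (2 * sin (pi * ((1 / (2 * pi)) *\<^sub>R v + - 1/2))) = ln (max (norm (1 + cis v)) a)"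
        using mono[of x y] y x a unfolding y_def[symmetric] by (simp add: max_def)
    qed
  qed
  have I3: "((\<lambda>v. ln (max (norm (1 + cis v)) a)) has_integral 4 * pi * x * ln a) {p..q}"
  proof -
    have "((\<lambda>v. ln a) has_integral 4 * pi * x * ln a) {p..q}"
      using has_integral_const_real[of "ln a" p q] pq by (simp add: p_def q_def algebra_simps)
    then show ?thesis
    proof (rule has_integral_eq[rotated])
      fix v assume v: "v \<in> {p..q}"
      define y where "y = \<bar>v - pi\<bar> / (2 * pi)"
      have y: "0 \<le> y" "y \<le> x" using v by (auto simp: y_def p_def q_def field_simps)
      have "v = pi - 2 * pi * y \<or> v = pi + 2 * pi * y" by (auto simp: y_def)
      then have "norm (1 + cis v) = 2 * \<bar>sin (pi * y)\<bar>"
        unfolding norm_one_plus_cis by (rule c1)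
      moreover have "0 \<le> sin (pi * y)" using mono[of 0 y] y x by simp
      ultimately show "ln a = ln (max (norm (1 + cis v)) a)"
        using mono[of y x] y x a by (simp add: max_def)
    qed
  qed
  have "((\<lambda>v. ln (max (norm (1 + cis v)) a)) has_integral 2 * pi * log_sine x + 4 * pi * x * ln a + 2 * pi * log_sine x) {0..2 * pi}"
    using pq by (intro has_integral_combine[OF _ _ has_integral_combine[OF _ _ I1 I3] I2]) auto
  then show ?thesis by (simp add: algebra_simps)
qed

section \<open>The integral of one linear factor over the torus\<close>

lemma cis_measurable [measurable]: "cis \<in> borel_measurable borel"
  by (intro borel_measurable_continuous_onI continuous_intros)

text \<open>Split the translated period at \<open>p\<close> and move the part beyond
  \<open>p\<close> back by one period. Half-open intervals make the pieces fit together
  exactly.\<close>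

lemma nn_integral_periodic_shift:
  fixes h :: "real \<Rightarrow> ennreal"
  assumes [measurable]: "h \<in> borel_measurable borel"
    and per: "\<And>t. h (t + p) = h t" and s: "0 \<le> s" "s \<le> p"
  shows "(\<integral>\<^sup>+v. h (s + v) * indicator {0..p} v \<partial>lborel) = (\<integral>\<^sup>+t. h t * indicator {0..p} t \<partial>lborel)"
proof -
  have half: "(\<integral>\<^sup>+v. k v * indicator {0..p} v \<partial>lborel) = (\<integral>\<^sup>+v. k v * indicator {0..<p} v \<partial>lborel)"
    for k :: "real \<Rightarrow> ennreal"
    using AE_lborel_singleton[of p]
    by (intro nn_integral_cong_AE) (auto elim!: eventually_mono split: split_indicator)
  have "(\<integral>\<^sup>+v. h (s + v) * indicator {0..<p} v \<partial>lborel) =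
      (\<integral>\<^sup>+v. h (s + 1 * v) * indicator {s..<s + p} (s + 1 * v) \<partial>lborel)"
    by (intro nn_integral_cong) (auto split: split_indicator)
  also have "\<dots> = (\<integral>\<^sup>+w. h w * indicator {s..<s + p} w \<partial>lborel)"
    by (subst nn_integral_real_affine[where c = 1 and t = s]) auto
  also have "\<dots> = (\<integral>\<^sup>+w. h w * indicator {s..<p} w + h w * indicator {p..<s + p} w \<partial>lborel)"
    using s by (intro nn_integral_cong) (auto split: split_indicator)
  also have "\<dots> = (\<integral>\<^sup>+w. h w * indicator {s..<p} w \<partial>lborel) + (\<integral>\<^sup>+w. h w * indicator {p..<s + p} w \<partial>lborel)"
    by (intro nn_integral_add) auto
  also have "(\<integral>\<^sup>+w. h w * indicator {p..<s + p} w \<partial>lborel) =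
      (\<integral>\<^sup>+w. h (p + 1 * w) * indicator {p..<s + p} (p + 1 * w) \<partial>lborel)"
    by (subst nn_integral_real_affine[where c = 1 and t = p]) auto
  also have "\<dots> = (\<integral>\<^sup>+w. h w * indicator {0..<s} w \<partial>lborel)"
    using per by (intro nn_integral_cong) (auto split: split_indicator simp: add.commute)
  also have "(\<integral>\<^sup>+w. h w * indicator {s..<p} w \<partial>lborel) + (\<integral>\<^sup>+w. h w * indicator {0..<s} w \<partial>lborel) =
      (\<integral>\<^sup>+w. h w * indicator {s..<p} w + h w * indicator {0..<s} w \<partial>lborel)"
    by (intro nn_integral_add[symmetric]) auto
  also have "\<dots> = (\<integral>\<^sup>+w. h w * indicator {0..<p} w \<partial>lborel)"
    using s by (intro nn_integral_cong) (auto split: split_indicator)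
  finally show ?thesis unfolding half .
qed

text \<open>This makes \<open>ln 4 - ln (norm ...)\<close> nonnegative, so that Tonelli applies
  despite the logarithmic singularities. At a zero of the sum the convention \<open>ln 0 = 0\<close>
  keeps the bound true.\<close>

lemma ln_norm_sum_le:
  assumes "norm u \<le> 1" "norm v \<le> 1" "0 \<le> a" "a \<le> 2"
  shows "ln (norm (u + v + complex_of_real a)) \<le> ln 4"
proof (cases "u + v + complex_of_real a = 0")
  case False
  have "norm (u + v + complex_of_real a) \<le> norm u + norm v + norm (complex_of_real a)"
    by (intro norm_triangle_mono order_refl)
  also have "\<dots> \<le> 4" using assms by simp
  finally show ?thesis using False by simp
qed simp

lemma ln_max_norm_le:
  assumes "0 < a" "a \<le> 2"
  shows "ln (max (norm (1 + cis v)) a) \<le> ln 4"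
proof (rule ln_mono)
  show "max (norm (1 + cis v)) a \<le> 4"
    using norm_triangle_ineq[of 1 "cis v"] assms by simp
  show "0 < max (norm (1 + cis v)) a" using assms by (simp add: less_max_iff_disj)
qed

text \<open>Replacing \<open>t\<close> by \<open>s + v\<close> turns the linear form into
  \<open>(1 + cis v) * cis s + a\<close>. After exchanging the integrals, the inner one over
  \<open>s\<close> is Jensen's formula and the outer one over \<open>v\<close> is the mean of the
  maximum.\<close>

lemma nn_integral_ln_norm_linear:
  fixes x :: real
  assumes x: "0 < x" "x < 1/2" and a: "a = 2 * sin (pi * x)"
  shows "(\<integral>\<^sup>+z. ennreal (ln 4 - ln (norm (cis (fst z) + cis (snd z) + complex_of_real a))) *
      indicator ({0..2 * pi} \<times> {0..2 * pi}) z \<partial>lborel) =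
    ennreal ((2 * pi)\<^sup>2 * (ln 4 - 2 * (log_sine x + x * ln a)))"
proof -
  let ?I = "{0..2 * pi}"
  define g where "g s t = ennreal (ln 4 - ln (norm (cis s + cis t + complex_of_real a)))" for s t
  have g_meas [measurable]: "case_prod g \<in> borel_measurable (borel \<Otimes>\<^sub>M borel)"
    unfolding g_def by measurable
  have a2: "0 < a" "a \<le> 2"
    using x sin_gt_zero[of "pi * x"] by (auto simp: a)
  have per: "g s (t + 2 * pi) = g s t" for s t
    by (simp add: g_def cis_mult[symmetric])
  have "(\<integral>\<^sup>+z. ennreal (ln 4 - ln (norm (cis (fst z) + cis (snd z) + complex_of_real a))) *
      indicator (?I \<times> ?I) z \<partial>lborel) = (\<integral>\<^sup>+z. case_prod g z * indicator (?I \<times> ?I) z \<partial>(lborel \<Otimes>\<^sub>M lborel))"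
    unfolding lborel_prod by (simp add: g_def case_prod_beta)
  also have "\<dots> = (\<integral>\<^sup>+s. \<integral>\<^sup>+t. case_prod g (s, t) * indicator (?I \<times> ?I) (s, t) \<partial>lborel \<partial>lborel)"
    by (subst lborel.nn_integral_fst) simp_all
  also have "\<dots> = (\<integral>\<^sup>+s. (\<integral>\<^sup>+t. g s t * indicator ?I t \<partial>lborel) * indicator ?I s \<partial>lborel)"
    by (subst nn_integral_multc[symmetric]) (simp_all add: indicator_times mult_ac)
  also have "\<dots> = (\<integral>\<^sup>+s. (\<integral>\<^sup>+v. g s (s + v) * indicator ?I v \<partial>lborel) * indicator ?I s \<partial>lborel)"
  proof (rule nn_integral_cong)
    fix s :: real
    show "(\<integral>\<^sup>+t. g s t * indicator ?I t \<partial>lborel) * indicator ?I s =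
      (\<integral>\<^sup>+v. g s (s + v) * indicator ?I v \<partial>lborel) * indicator ?I s"
    proof (cases "s \<in> ?I")
      case True
      then show ?thesis
        using nn_integral_periodic_shift[of "g s" "2 * pi" s] per by simp
    qed simp
  qed
  also have "\<dots> = (\<integral>\<^sup>+s. \<integral>\<^sup>+v. g s (s + v) * indicator ?I v * indicator ?I s \<partial>lborel \<partial>lborel)"
    by (subst nn_integral_multc) simp_all
  also have "\<dots> = (\<integral>\<^sup>+v. \<integral>\<^sup>+s. g s (s + v) * indicator ?I v * indicator ?I s \<partial>lborel \<partial>lborel)"
    by (rule lborel_pair.Fubini'[symmetric]) simp
  also have "\<dots> = (\<integral>\<^sup>+v. ennreal (indicator ?I v * (2 * pi * (ln 4 - ln (max (norm (1 + cis v)) a)))) \<partial>lborel)"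
  proof (rule nn_integral_cong_AE)
    \<comment> \<open>These \<open>v\<close> are exactly those for which Jensen's formula was not
      established.\<close>
    have "AE v in lborel. v \<notin> {v. norm (1 + cis v) = a}"
      by (intro AE_not_in countable_imp_null_set_lborel countable_norm_one_plus_cis_eq)
    then show "AE v in lborel. (\<integral>\<^sup>+s. g s (s + v) * indicator ?I v * indicator ?I s \<partial>lborel) =
      ennreal (indicator ?I v * (2 * pi * (ln 4 - ln (max (norm (1 + cis v)) a))))"
    proof eventually_elim
      case (elim v)
      have *: "cis s + cis (s + v) + complex_of_real a = (1 + cis v) * cis s + of_real a" for s
        by (simp add: cis_mult[symmetric] algebra_simps)
      have "((\<lambda>s. ln 4 - ln (norm ((1 + cis v) * cis s + of_real a))) has_integral
          2 * pi * ln 4 - 2 * pi * ln (max (norm (1 + cis v)) a)) ?I"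
        using has_integral_const_real[of "ln 4 :: real" 0 "2 * pi"] elim a2
        by (intro has_integral_diff has_integral_ln_norm_circle) auto
      then have "(\<integral>\<^sup>+s. ennreal (indicator ?I s * (ln 4 - ln (norm ((1 + cis v) * cis s + of_real a)))) \<partial>lborel) =
          ennreal (2 * pi * ln 4 - 2 * pi * ln (max (norm (1 + cis v)) a))"
        using a2 unfolding *[symmetric]
        by (intro nn_integral_has_integral_lebesgue) (auto intro!: ln_norm_sum_le)
      moreover have "(\<integral>\<^sup>+s. g s (s + v) * indicator ?I v * indicator ?I s \<partial>lborel) =
         (\<integral>\<^sup>+s. indicator ?I v * ennreal (indicator ?I s * (ln 4 - ln (norm ((1 + cis v) * cis s + of_real a)))) \<partial>lborel)"
        unfolding g_def * by (intro nn_integral_cong) (auto split: split_indicator)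
      moreover have "\<dots> = indicator ?I v * (\<integral>\<^sup>+s. ennreal (indicator ?I s * (ln 4 - ln (norm ((1 + cis v) * cis s + of_real a)))) \<partial>lborel)"
        by (intro nn_integral_cmult) measurable
      ultimately show ?case by (auto split: split_indicator simp: algebra_simps)
    qed
  qed
  also have "\<dots> = ennreal (2 * pi * (2 * pi * ln 4 - 4 * pi * (log_sine x + x * ln a)))"
  proof (rule nn_integral_has_integral_lebesgue)
    show "((\<lambda>v. 2 * pi * (ln 4 - ln (max (norm (1 + cis v)) a))) has_integral
        2 * pi * (2 * pi * ln 4 - 4 * pi * (log_sine x + x * ln a))) ?I"
      using has_integral_const_real[of "ln 4 :: real" 0 "2 * pi"]
      by (intro has_integral_mult_right has_integral_diff has_integral_ln_max_norm x a) auto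
    fix v :: real
    show "0 \<le> 2 * pi * (ln 4 - ln (max (norm (1 + cis v)) a))"
      using ln_max_norm_le[OF a2, of v] by (intro mult_nonneg_nonneg) auto
  qed
  also have "2 * pi * (2 * pi * ln 4 - 4 * pi * (log_sine x + x * ln a)) = (2 * pi)\<^sup>2 * (ln 4 - 2 * (log_sine x + x * ln a))"
    by (simp add: power2_eq_square algebra_simps)
  finally show ?thesis .
qed

text \<open>Integrating the pointwise bound shows that the real number under \<open>ennreal\<close>
  in the previous result is nonnegative, hence not truncated to 0.\<close>

lemma log_sine_bound:
  assumes x: "0 < x" "x < 1/2" and a: "a = 2 * sin (pi * x)"
  shows "2 * (log_sine x + x * ln a) \<le> ln 4"
proof -
  have a2: "0 < a" "a \<le> 2"
    using x sin_gt_zero[of "pi * x"] by (auto simp: a)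
  have "((\<lambda>v. ln 4) has_integral 2 * pi * ln 4) {0..2 * pi}"
    using has_integral_const_real[of "ln 4 :: real" 0 "2 * pi"] by simp
  moreover have "ln (max (norm (1 + cis v)) a) \<le> ln 4" for v
    using ln_max_norm_le[OF a2] .
  ultimately have "4 * pi * (log_sine x + x * ln a) \<le> 2 * pi * ln 4"
    using has_integral_le[OF has_integral_ln_max_norm[OF x a]] by blast
  then have "(2 * pi) * (2 * (log_sine x + x * ln a)) \<le> (2 * pi) * ln 4" by (simp add: algebra_simps)
  then show ?thesis by (rule mult_left_le_imp_le) simp
qed

lemma has_bochner_integral_square_const:
  "has_bochner_integral lborel (\<lambda>z. indicator ({0..2 * pi} \<times> {0..2 * pi}) z *\<^sub>R (c::real)) ((2 * pi)\<^sup>2 * c)"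
proof -
  have "emeasure lborel ({0..2 * pi} \<times> {0..2 * pi}) = emeasure (lborel \<Otimes>\<^sub>M lborel) ({0..2 * pi} \<times> {0..2 * pi})"
    by (simp add: lborel_prod)
  also have "\<dots> = ennreal (2 * pi) * ennreal (2 * pi)"
    by (subst lborel.emeasure_pair_measure_Times) auto
  also have "\<dots> = ennreal ((2 * pi)\<^sup>2)"
    by (simp add: ennreal_mult[symmetric] power2_eq_square)
  finally have e: "emeasure lborel ({0..2 * pi} \<times> {0..2 * pi}) = ennreal ((2 * pi)\<^sup>2)" .
  have S: "{0..2 * pi} \<times> {0..2 * pi} \<in> sets lborel"
    by (auto intro!: borel_closed closed_Times)
  have "has_bochner_integral lborel (indicator ({0..2 * pi} \<times> {0..2 * pi}) :: _ \<Rightarrow> real) ((2 * pi)\<^sup>2)"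
    using has_bochner_integral_real_indicator[OF S] e by (simp add: measure_def)
  then show ?thesis
    using has_bochner_integral_mult_left[of c lborel "indicator ({0..2 * pi} \<times> {0..2 * pi})"] by simp
qed

text \<open>The finite integral of the nonnegative function \<open>ln 4 - ln (norm ...)\<close>
  gives integrability. Subtracting it from the integral of the constant \<open>ln 4\<close> gives
  the value.\<close>

lemma has_bochner_integral_ln_norm_linear:
  assumes x: "0 < x" "x < 1/2" and a: "a = 2 * sin (pi * x)"
  shows "has_bochner_integral lborel (\<lambda>z. indicator ({0..2 * pi} \<times> {0..2 * pi}) z *\<^sub>R
     ln (norm (cis (fst z) + cis (snd z) + complex_of_real a)))
     ((2 * pi)\<^sup>2 * (2 * log_sine x + 2 * x * ln a))"
proof -
  let ?S = "{0..2 * pi} \<times> {0..2 * pi}"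
  let ?F = "\<lambda>z. ln (norm (cis (fst z) + cis (snd z) + complex_of_real a))"
  have a2: "0 < a" "a \<le> 2"
    using x sin_gt_zero[of "pi * x"] by (auto simp: a)
  have [measurable]: "(\<lambda>z. cis (fst z) + cis (snd z) + complex_of_real a) \<in> borel_measurable borel"
    by (intro borel_measurable_continuous_onI continuous_intros)
  have S [measurable]: "?S \<in> sets borel" by (intro borel_closed closed_Times) auto
  have "has_bochner_integral lborel (\<lambda>z. indicator ?S z *\<^sub>R (ln 4 - ?F z)) ((2 * pi)\<^sup>2 * (ln 4 - 2 * (log_sine x + x * ln a)))"
  proof (rule has_bochner_integral_nn_integral)
    show "AE z in lborel. 0 \<le> indicator ?S z *\<^sub>R (ln 4 - ?F z)"
      using a2 by (intro always_eventually allI) (auto split: split_indicator intro!: ln_norm_sum_le)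
    show "0 \<le> (2 * pi)\<^sup>2 * (ln 4 - 2 * (log_sine x + x * ln a))"
      using log_sine_bound[OF x a] by simp
    show "(\<integral>\<^sup>+z. ennreal (indicator ?S z *\<^sub>R (ln 4 - ?F z)) \<partial>lborel) = ennreal ((2 * pi)\<^sup>2 * (ln 4 - 2 * (log_sine x + x * ln a)))"
      unfolding nn_integral_ln_norm_linear[OF x a, symmetric]
      by (intro nn_integral_cong) (auto split: split_indicator)
  qed measurable
  from has_bochner_integral_diff[OF has_bochner_integral_square_const[of "ln 4"] this]
  show ?thesis by (simp add: algebra_simps)
qed

text \<open>For each \<open>s\<close> only countably many \<open>t\<close> give a zero. Off this
  null set the logarithm of the product, including negative exponents, splits into a sum.\<close>

lemma AE_linear_form_nonzero:
  "AE z in lborel. cis (fst z) + cis (snd z) + complex_of_real a \<noteq> 0"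
proof -
  have "AE z in lborel \<Otimes>\<^sub>M lborel. cis (fst z) + cis (snd z) + complex_of_real a \<noteq> 0"
  proof (rule lborel_pair.AE_pair_measure)
    show "{z \<in> space (lborel \<Otimes>\<^sub>M lborel). cis (fst z) + cis (snd z) + complex_of_real a \<noteq> 0} \<in> sets (lborel \<Otimes>\<^sub>M lborel)"
      by measurable
    show "AE s in lborel. AE t in lborel. cis (fst (s, t)) + cis (snd (s, t)) + complex_of_real a \<noteq> 0"
    proof (rule AE_I2)
      fix s :: real
      have "AE t in lborel. t \<notin> {t. cis t = - (cis s + complex_of_real a)}"
        by (intro AE_not_in countable_imp_null_set_lborel countable_cis_eq)
      moreover have "cis t = - (cis s + complex_of_real a)" if "cis s + cis t + complex_of_real a = 0" for t
      proof -
        have "cis t + (cis s + complex_of_real a) = 0" using that by (simp add: add_ac)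
        then show ?thesis by (rule eq_neg_iff_add_eq_0[THEN iffD2])
      qed
      ultimately have "AE t in lborel. cis s + cis t + complex_of_real a \<noteq> 0"
        by (elim eventually_mono) blast
      then show "AE t in lborel. cis (fst (s, t)) + cis (snd (s, t)) + complex_of_real a \<noteq> 0"
        by simp
    qed
  qed
  then show ?thesis unfolding lborel_prod .
qed

section \<open>Assembly of the identity\<close>

lemma ln_power_int:
  fixes r :: real
  assumes "r > 0"
  shows "ln (r powi n) = of_int n * ln r"
  using powr_real_of_int'[of r n] assms by (metis less_eq_real_def ln_powr order_less_irrefl)

lemma power_int_borel_measurable:
  fixes F :: "'a \<Rightarrow> complex"
  assumes [measurable]: "F \<in> borel_measurable M"
  shows "(\<lambda>z. F z powi n) \<in> borel_measurable M"
  unfolding power_int_def by (cases "n \<ge> 0") simp_all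

theorem theorem4p1:
  fixes f :: nat
  assumes "f > 0"
    and "fundamental_discriminant (- int f)"
  shows "complex_of_real (mahler_measure2 (\<lambda>x y.
           of_real (alpha f) *
           (\<Prod>u | 0 < u \<and> real u < real f / 2.
              (x + y + of_real (2 * sin (pi * real u / real f))) powi (chi_neg f u * int f))))
         = 2 * deriv (dirichlet_L (\<lambda>n. of_int (chi_neg f n))) (-1)"
proof -
  define A where "A = {u. 0 < u \<and> 2 * u < f}"
  have A: "{u. 0 < u \<and> real u < real f / 2} = A" by (auto simp: A_def)
  have fin: "finite A" unfolding A_def by (rule finite_subset[of _ "{..<f}"]) auto
  define x where "x u = real u / real f" for u
  define r where "r u = 2 * sin (pi * real u / real f)" for u
  have x: "0 < x u" "x u < 1/2" "r u = 2 * sin (pi * x u)" if "u \<in> A" for u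
    using that assms(1) by (auto simp: A_def x_def r_def field_simps)
  have r: "r u > 0" if "u \<in> A" for u
    using x[OF that] sin_gt_zero[of "pi * x u"] by simp
  obtain g where "kronecker_extends (- int f) g"
    using fundamental_kronecker_extends[OF assms(2)] by blast
  then have g: "\<And>n. n > 0 \<Longrightarrow> chi_neg f n = g (int n)" "\<And>k. g (k + int f) = g k" "\<And>k. g (- k) = - g k"
    using assms(1) by (auto simp: kronecker_extends_def chi_neg_def)
  have deriv: "deriv (dirichlet_L (\<lambda>n. of_int (chi_neg f n))) (-1) =
    of_nat f * (\<Sum>u\<in>A. of_int (chi_neg f u) * of_real (log_sine (x u)))"
    unfolding A_def x_def
  proof (rule deriv_dirichlet_L_odd_periodic[OF assms(1)])
    show "of_int (chi_neg f (n + f)) = (of_int (chi_neg f n) :: complex)" if "n > 0" for n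
      using that g(1)[of n] g(1)[of "n + f"] g(2)[of "int n"] by simp
    show "of_int (chi_neg f (f - u)) = - (of_int (chi_neg f u) :: complex)" if "0 < u" "u < f" for u
      using that g(1)[of u] g(1)[of "f - u"] g(2)[of "- int u"] g(3)[of "int u"] by simp
    \<comment> \<open>Oddness gives \<open>g 0 = 0\<close>, and periodicity carries this to
      \<open>f\<close>.\<close>
    show "of_int (chi_neg f f) = (0 :: complex)"
      using assms(1) g(1)[of f] g(2)[of 0] g(3)[of 0] by simp
  qed
  let ?S = "{0..2 * pi} \<times> {0..2 * pi}"
  define F where "F u z = cis (fst z) + cis (snd z) + complex_of_real (r u)" for u and z :: "real \<times> real"
  have F_meas [measurable]: "F u \<in> borel_measurable borel" for u
    unfolding F_def[abs_def] by (intro borel_measurable_continuous_onI continuous_intros)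
  have S [measurable]: "?S \<in> sets borel" by (intro borel_closed closed_Times) auto
  define P where "P z = complex_of_real (alpha f) * (\<Prod>u\<in>A. F u z powi (chi_neg f u * int f))" for z
  have P_meas [measurable]: "P \<in> borel_measurable borel"
    unfolding P_def[abs_def] by (intro borel_measurable_times borel_measurable_const borel_measurable_prod power_int_borel_measurable F_meas)
  define k where "k u = real_of_int (chi_neg f u) * real f" for u
  have alpha: "alpha f = (\<Prod>u\<in>A. r u powi (- 2 * chi_neg f u * int u))"
    unfolding alpha_def A r_def[symmetric] using r by (intro prod.cong refl) (simp add: abs_of_pos)
  have alpha_pos: "alpha f > 0" unfolding alpha by (intro prod_pos ballI zero_less_power_int r)
  \<comment> \<open>Since \<open>u = f * x u\<close>, the exponents of \<open>alpha\<close> are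
    those of the linear factors times \<open>- 2 * x u\<close>; they are made to cancel the terms
    \<open>2 * x u * ln (r u)\<close> of the individual integrals.\<close>
  have ln_alpha: "ln (alpha f) = (\<Sum>u\<in>A. k u * (- 2 * x u * ln (r u)))"
  proof -
    have "ln (alpha f) = (\<Sum>u\<in>A. ln (r u powi (- 2 * chi_neg f u * int u)))"
      unfolding alpha using fin by (intro ln_prod) (force dest: r)+
    also have "\<dots> = (\<Sum>u\<in>A. k u * (- 2 * x u * ln (r u)))"
      using r assms(1) by (intro sum.cong refl) (simp add: ln_power_int k_def x_def)
    finally show ?thesis .
  qed
  have "has_bochner_integral lborel
     (\<lambda>z. indicator ?S z *\<^sub>R ln (alpha f) + (\<Sum>u\<in>A. k u * (indicator ?S z *\<^sub>R ln (norm (F u z)))))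
     ((2 * pi)\<^sup>2 * ln (alpha f) + (\<Sum>u\<in>A. k u * ((2 * pi)\<^sup>2 * (2 * log_sine (x u) + 2 * x u * ln (r u)))))"
    unfolding F_def
    by (intro has_bochner_integral_add has_bochner_integral_sum has_bochner_integral_mult_right
        has_bochner_integral_square_const has_bochner_integral_ln_norm_linear x)
  also have "(2 * pi)\<^sup>2 * ln (alpha f) + (\<Sum>u\<in>A. k u * ((2 * pi)\<^sup>2 * (2 * log_sine (x u) + 2 * x u * ln (r u)))) =
     (2 * pi)\<^sup>2 * (\<Sum>u\<in>A. 2 * k u * log_sine (x u))"
    unfolding ln_alpha sum_distrib_left sum.distrib[symmetric]
    by (intro sum.cong refl) (simp add: algebra_simps)
  finally have I: "has_bochner_integral lborel
     (\<lambda>z. indicator ?S z *\<^sub>R ln (alpha f) + (\<Sum>u\<in>A. k u * (indicator ?S z *\<^sub>R ln (norm (F u z)))))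
     ((2 * pi)\<^sup>2 * (\<Sum>u\<in>A. 2 * k u * log_sine (x u)))" .
  have "AE z in lborel. \<forall>u\<in>A. F u z \<noteq> 0"
    unfolding F_def using fin by (intro AE_finite_allI AE_linear_form_nonzero)
  then have "AE z in lborel. indicator ?S z *\<^sub>R ln (norm (P z)) =
     indicator ?S z *\<^sub>R ln (alpha f) + (\<Sum>u\<in>A. k u * (indicator ?S z *\<^sub>R ln (norm (F u z))))"
  proof eventually_elim
    case (elim z)
    have "ln (norm (P z)) = ln (alpha f * (\<Prod>u\<in>A. norm (F u z) powi (chi_neg f u * int f)))"
      using alpha_pos by (simp add: P_def norm_mult prod_norm[symmetric] norm_power_int)
    also have "\<dots> = ln (alpha f) + ln (\<Prod>u\<in>A. norm (F u z) powi (chi_neg f u * int f))"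
      using alpha_pos elim by (intro ln_mult_pos prod_pos ballI zero_less_power_int) auto
    also have "ln (\<Prod>u\<in>A. norm (F u z) powi (chi_neg f u * int f)) =
        (\<Sum>u\<in>A. ln (norm (F u z) powi (chi_neg f u * int f)))"
      using fin elim by (intro ln_prod) auto
    also have "\<dots> = (\<Sum>u\<in>A. k u * ln (norm (F u z)))"
      using elim by (intro sum.cong refl) (simp add: ln_power_int k_def)
    finally have e: "ln (norm (P z)) = ln (alpha f) + (\<Sum>u\<in>A. k u * ln (norm (F u z)))" .
    show ?case
      by (cases "z \<in> ?S") (simp_all add: e)
  qed
  then have "integral\<^sup>L lborel (\<lambda>z. indicator ?S z *\<^sub>R ln (norm (P z))) =
     integral\<^sup>L lborel (\<lambda>z. indicator ?S z *\<^sub>R ln (alpha f) + (\<Sum>u\<in>A. k u * (indicator ?S z *\<^sub>R ln (norm (F u z)))))"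
    by (intro integral_cong_AE) measurable
  also have "\<dots> = (2 * pi)\<^sup>2 * (\<Sum>u\<in>A. 2 * k u * log_sine (x u))"
    using I by (rule has_bochner_integral_integral_eq)
  finally have "mahler_measure2 (\<lambda>x y. complex_of_real (alpha f) *
      (\<Prod>u\<in>A. (x + y + of_real (r u)) powi (chi_neg f u * int f))) = (\<Sum>u\<in>A. 2 * k u * log_sine (x u))"
    unfolding mahler_measure2_def set_lebesgue_integral_def P_def F_def by simp
  then show ?thesis
    unfolding A deriv r_def k_def by (simp add: sum_distrib_left mult_ac)
qed

end
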